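(* Let $G = C_2 \oplus C_2 \oplus C_{2n}$ with $n\geq 1$. Then $\nu (G) = \nu_2 (G) = \mathsf d (G)-1$.
   Context: $C_m$ denotes the cyclic group of order $m$. For a finite abelian group $G$ (written additively) let $G^{\bullet} = G\setminus\{0\}$. A sequence over $G$ is a finite unordered sequence of elements of $G$ with repetition allowed (an element of the free abelian monoid with basis $G$, written multiplicatively; the empty sequence is allowed); $|T|$ is the length of $T$, and $\Sigma(T)$ is the set of all sums of nonempty subsequences of $T$. $T$ is zero-sum free if $0\notin\Sigma(T)$. $\mathsf d(G)$ is the maximal length of a zero-sum free sequence over $G$. For nontrivial $G$, $\nu(G)$ is the smallest integer $\ell$ such that for every zero-sum free sequence $T$ over $G$ with $|T|\ge \ell$ there are a subgroup $H\subsetneq G$ and some $\alpha\in G\setminus H$ with $G^{\bullet}\setminus\Sigma(T)\subseteq\alpha+H$. For a prime divisor $p$ of $|G|$, $\nu_p(G)$ is the smallest integer $\ell$ such that for every zero-sum free sequence $T$ over $G$ with $|T|\ge\ell$ there are a subgroup $H\subseteq G$ with index $(G:H)=p$ and some $\alpha\in G\setminus H$ with $G^{\bullet}\setminus\Sigma(T)\subseteq\alpha+H$. *)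

theory Defs
  imports "HOL-Algebra.Elementary_Groups" "HOL-Algebra.FiniteProduct" "HOL-Library.Multiset"
begin

text \<open>
  Groups are the record-based groups of HOL-Algebra, hence written multiplicatively: \<open>\<one>\<close> is the
  zero element and \<open>\<otimes>\<close> is the addition. A sequence over \<open>G\<close> is a finite multiset
  whose members lie in \<open>carrier G\<close>; its length is \<open>size\<close> and its subsequences are its
  sub-multisets.
\<close>

definition seq_over :: "('a, 'b) monoid_scheme \<Rightarrow> 'a multiset \<Rightarrow> bool" where
  "seq_over G T \<longleftrightarrow> set_mset T \<subseteq> carrier G"

text \<open>The sum of a sequence, computed with multiplicities: \<open>\<Sum>\<^sub>g v\<^sub>g(T) g\<close> over the
  members \<open>g\<close> of \<open>T\<close>.\<close>

definition seq_sum :: "('a, 'b) monoid_scheme \<Rightarrow> 'a multiset \<Rightarrow> 'a" where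
  "seq_sum G T = finprod G (\<lambda>g. g [^]\<^bsub>G\<^esub> count T g) (set_mset T)"

definition subseq_sums :: "('a, 'b) monoid_scheme \<Rightarrow> 'a multiset \<Rightarrow> 'a set" where
  "subseq_sums G T = {seq_sum G S | S. S \<subseteq># T \<and> S \<noteq> {#}}"

definition zero_sum_free :: "('a, 'b) monoid_scheme \<Rightarrow> 'a multiset \<Rightarrow> bool" where
  "zero_sum_free G T \<longleftrightarrow> seq_over G T \<and> \<one>\<^bsub>G\<^esub> \<notin> subseq_sums G T"

text \<open>For finite \<open>G\<close> the set below is finite and contains 0 (the empty sequence).\<close>

definition small_davenport :: "('a, 'b) monoid_scheme \<Rightarrow> nat" where
  "small_davenport G = Max {size T | T. zero_sum_free G T}"

definition nonzero_elems :: "('a, 'b) monoid_scheme \<Rightarrow> 'a set" where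
  "nonzero_elems G = carrier G - {\<one>\<^bsub>G\<^esub>}"

text \<open>
  In \<open>nu\<close> and \<open>nu_p\<close> the minimum is over natural numbers: the conditions for negative bounds
  coincide with the one for 0. For finite \<open>G\<close> the minimum exists, as the condition is vacuous
  beyond \<open>small_davenport G\<close>. They are meant for nontrivial \<open>G\<close> and for prime divisors \<open>p\<close> of
  \<open>order G\<close>, respectively.
\<close>

definition nu :: "('a, 'b) monoid_scheme \<Rightarrow> nat" where
  "nu G = (LEAST l. \<forall>T. zero_sum_free G T \<and> size T \<ge> l \<longrightarrow>
     (\<exists>H \<alpha>. subgroup H G \<and> H \<subset> carrier G \<and> \<alpha> \<in> carrier G - H \<and>
        nonzero_elems G - subseq_sums G T \<subseteq> \<alpha> <#\<^bsub>G\<^esub> H))"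

definition nu_p :: "nat \<Rightarrow> ('a, 'b) monoid_scheme \<Rightarrow> nat" where
  "nu_p p G = (LEAST l. \<forall>T. zero_sum_free G T \<and> size T \<ge> l \<longrightarrow>
     (\<exists>H \<alpha>. subgroup H G \<and> card (rcosets\<^bsub>G\<^esub> H) = p \<and> \<alpha> \<in> carrier G - H \<and>
        nonzero_elems G - subseq_sums G T \<subseteq> \<alpha> <#\<^bsub>G\<^esub> H))"

end

theory Submission
  imports Defs "HOL-Library.Z2" "HOL-Library.Product_Plus"
begin

text \<open>
  The subgroup \<open>2G\<close> is cyclic of order \<open>n\<close> and \<open>V = G/2G\<close> is elementary abelian of order 8. The heart of
  the matter is that a zero-sum free \<open>T\<close> of length \<open>2n\<close> has an index-2 subgroup inside
  \<open>\<Sigma>(T) \<union> {0}\<close>. Pair off equal classes of \<open>V\<close> in \<open>T\<close>: this gives blocks with sum in \<open>2G\<close> and a rest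
  \<open>R\<close> of distinct nonzero classes with \<open>2 \<cdot> #blocks + |R| \<ge> 2n\<close>. Since \<open>k\<close> block sums that are zero-sum free have
  at least \<open>k + 1\<close> subsums in \<open>2G\<close>, at most \<open>n - 1\<close> blocks exist, and with \<open>n - 1\<close>, \<open>n - 2\<close> or \<open>n - 3\<close> blocks
  only 0, 1 or 2 elements of \<open>2G\<close> are missed, among them the negative of every disjoint sum lying in
  \<open>2G\<close>. This leaves four cases for \<open>R\<close>: two elements, a Fano line with a further point, the complement of
  a Fano line, and six points. In each of them, if no index-2 subgroup were covered, comparing the missed
  elements obtained from different blocks would make a block sum vanish.

  The bound \<open>d(G) \<le> 2n + 1\<close> follows: two elements added to \<open>T\<close> must lie outside the covered subgroup, so
  their sum lies inside. The sequence \<open>g\<^sup>2\<^sup>n\<^sup>-\<^sup>1\<close> with \<open>g\<close> of order \<open>2n\<close> shows that length \<open>2n - 1\<close> does not suffice.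
\<close>

section \<open>Sequences of lifted elements\<close>

text \<open>
  Elements of \<open>G\<close> are lifted to \<open>bit \<times> bit \<times> int\<close>, with \<open>null n\<close> describing the kernel. Two elements
  with the same class \<open>cls\<close> modulo \<open>2G\<close> differ modulo the kernel by the
    difference of their integer coordinates
  \<open>val\<close> only, which is even.
\<close>

type_synonym elt = "bit \<times> bit \<times> int"

definition val :: "elt \<Rightarrow> int" where
  "val x = snd (snd x)"

definition cls :: "elt \<Rightarrow> bit \<times> bit \<times> bit" where
  "cls x = (fst x, fst (snd x), of_int (val x))"

definition null :: "nat \<Rightarrow> elt \<Rightarrow> bool" where
  "null n x \<longleftrightarrow> cls x = 0 \<and> 2 * int n dvd val x"

text \<open>The empty subsequence is allowed, so this describes the set of subsums together with
  0.\<close>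

definition reach :: "nat \<Rightarrow> elt multiset \<Rightarrow> elt \<Rightarrow> bool" where
  "reach n T g \<longleftrightarrow> (\<exists>S. S \<subseteq># T \<and> null n (sum_mset S - g))"

definition zfree :: "nat \<Rightarrow> elt multiset \<Rightarrow> bool" where
  "zfree n T \<longleftrightarrow> (\<forall>S. S \<subseteq># T \<and> null n (sum_mset S)
    \<longrightarrow> S = {#})"

text \<open>Only integer coordinates are compared: \<open>D\<close> is meant to consist of elements
  of class 0, and sums of these are determined modulo the kernel by that coordinate.\<close>

definition hits :: "nat \<Rightarrow> elt multiset \<Rightarrow> int \<Rightarrow> bool" where
  "hits n D x \<longleftrightarrow> (\<exists>S. S \<subseteq># D \<and> 2 * int n dvd val (sum_mset S) - x)"

definition covered :: "nat \<Rightarrow> elt multiset \<Rightarrow> bit \<times> bit \<times> bit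
  \<Rightarrow> bool" where
  "covered n T v \<longleftrightarrow> (\<forall>g. cls g = v \<longrightarrow> reach n T g)"

text \<open>The classes \<open>0, v, w, v + w\<close> form a plane of V; its preimage is a subgroup
  of index 2, and every subgroup of index 2 arises in this way.\<close>

definition good :: "nat \<Rightarrow> elt multiset \<Rightarrow> bool" where
  "good n T \<longleftrightarrow> (\<exists>v w. v \<noteq> 0 \<and> w \<noteq> 0 \<and> v \<noteq> w \<and>
     covered n T 0 \<and> covered n T v \<and> covered n T w \<and> covered n T (v + w))"

section \<open>Arithmetic in the elementary abelian group of order 8\<close>

lemma bit_add_self [simp]: "x + x = (0::bit)"
  by (cases x) simp_all

lemma cube_add_self [simp]: "v + v = (0 :: bit \<times> bit \<times> bit)"
  by (simp add: prod_eq_iff)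

lemma cube_add_self_left [simp]: "v + (v + w) = (w :: bit \<times> bit \<times> bit)"
  by (simp add: add.assoc [symmetric])

lemma cube_diff [simp]: "v - w = v + (w :: bit \<times> bit \<times> bit)"
  by (simp add: prod_eq_iff)

lemma cube_add_eq_0_iff [simp]: "v + w = 0 \<longleftrightarrow> v = (w :: bit \<times> bit \<times> bit)"
  by (metis cube_diff eq_iff_diff_eq_0)

lemma cube_eq_iffs:
  fixes a b c :: "bit \<times> bit \<times> bit"
  shows "a + (b + c) = b \<longleftrightarrow> a = c" "a + (b + c) = c \<longleftrightarrow> a = b"
    "a + b = b + c \<longleftrightarrow> a = c"
    "b = a + (b + c) \<longleftrightarrow> a = c" "c = a + (b + c) \<longleftrightarrow> a = b"
      "b + c = a + b \<longleftrightarrow> a = c"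
  by (metis add.commute add.left_commute cube_add_self_left)+

lemma cube_UNIV: "finite (UNIV :: (bit \<times> bit \<times> bit) set)"
  "card (UNIV :: (bit \<times> bit \<times> bit) set) = 8"
proof -
  have *: "(UNIV :: bit set) = {0, 1}" by (auto intro: bit.exhaust)
  show "finite (UNIV :: (bit \<times> bit \<times> bit) set)"
    "card (UNIV :: (bit \<times> bit \<times> bit) set) = 8"
    unfolding UNIV_Times_UNIV[symmetric] * by (simp_all add: card_cartesian_product)
qed

lemma cube_span:
  fixes x y z v :: "bit \<times> bit \<times> bit"
  assumes "x \<noteq> 0" "y \<noteq> 0" "z \<noteq> 0" "x \<noteq> y" "x \<noteq> z" "y \<noteq> z"
    "x + y \<noteq> z"
  shows "v \<in> {0, x, y, z, x + y, x + z, y + z, x + y + z}"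
proof -
  let ?S = "{0, x, y, z, x + y, x + z, y + z, x + y + z}"
  have "x + z \<noteq> y" "y + z \<noteq> x"
    using assms(7) by (metis add.commute cube_add_self_left)+
  then have "card ?S = 8"
    using assms by (auto simp: card_insert_if add.assoc cube_eq_iffs)
  then have "?S = UNIV" using cube_UNIV by (intro card_subset_eq) auto
  then show ?thesis by blast
qed

text \<open>A plane has index 2, so two elements outside it lie in the same coset.\<close>

lemma plane_add:
  fixes v w a b :: "bit \<times> bit \<times> bit"
  assumes "v \<noteq> 0" "w \<noteq> 0" "v \<noteq> w" "a \<notin> {0, v, w, v + w}"
    "b \<notin> {0, v, w, v + w}"
  shows "a + b \<in> {0, v, w, v + w}"
proof -
  have "v + w \<noteq> a" "v \<noteq> a" "w \<noteq> a" "a \<noteq> 0" using assms(4) by blast+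
  from cube_span[OF assms(1,2) this(4) assms(3) this(2,3,1), of b] assms(5)
  have "b \<in> {a, v + a, w + a, v + w + a}" by blast
  then show ?thesis by (elim insertE emptyE; simp add: ac_simps)
qed

text \<open>At most one nonzero class is absent from \<open>C\<close>. With \<open>p\<close> this
  class, the three lines through \<open>p\<close> split the other six into pairs
  \<open>v, v + p\<close>, and \<open>a, b, a + b\<close> takes one member of each pair along a line
  missing \<open>p\<close>.\<close>

lemma six_classes:
  fixes C :: "(bit \<times> bit \<times> bit) set"
  assumes "0 \<notin> C" "card C \<ge> 6"
  obtains a b p where "a \<noteq> 0" "b \<noteq> 0" "a \<noteq> b" "p \<notin> {0, a, b, a + b}"
    "{a, a + p, b, b + p, a + b, a + b + p} \<subseteq> C"
proof -
  have fin: "finite A" for A :: "(bit \<times> bit \<times> bit) set"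
    using cube_UNIV(1) by (rule finite_subset[OF subset_UNIV])
  have "card (UNIV - insert 0 C) = 8 - (card C + 1)"
    using assms(1) cube_UNIV fin by (subst card_Diff_subset) auto
  then have "card (UNIV - insert 0 C) \<le> 1" using assms(2) by simp
  then obtain p0 where p0: "UNIV - insert 0 C \<subseteq> {p0}"
    using fin by (metis card_le_Suc0_iff_eq One_nat_def subsetI singletonI emptyE ex_in_conv
      subset_singleton_iff)
  have ex: "\<exists>v. v \<notin> A" if "card A < 8" for A :: "(bit \<times> bit \<times> bit) set"
    using that cube_UNIV by (metis UNIV_eq_I less_irrefl)
  \<comment> \<open>\<open>p0 = 0\<close> can occur only if all seven nonzero classes lie in
    \<open>C\<close>; then any nonzero \<open>p\<close> serves.\<close>
  define p where "p = (if p0 = 0 then (1, 1, 1) else p0)"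
  have p: "p \<noteq> 0" "v \<in> C" if "v \<noteq> 0" "v \<noteq> p" for v
    using p0 that assms(1) by (auto simp: p_def zero_prod_def split: if_splits)
  have pn: "p \<noteq> 0" by (auto simp: p_def zero_prod_def)
  have "card (set [0, p]) < 8" "card (set [0, p, v, v + p]) < 8" for v
    using card_length[of "[0, p]"] card_length[of "[0, p, v, v + p]"] by simp_all
  note small = this
  obtain a where a: "a \<notin> {0, p}" using ex[OF small(1)] by auto
  obtain b where b: "b \<notin> {0, p, a, a + p}" using ex[OF small(2)[of a]] by auto
  have "a + b \<noteq> p" using b by (metis cube_add_self_left insertCI)
  moreover from this have "a + b + p \<noteq> 0" by simp
  moreover have "a + p \<noteq> 0" "a + p \<noteq> p" "b + p \<noteq> 0" "b + p \<noteq> p"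
    "a + b \<noteq> 0" "a + b + p \<noteq> p"
    using a b by auto
  ultimately have "{a, a + p, b, b + p, a + b, a + b + p} \<subseteq> C" "p \<noteq> a + b"
    using a b p(2) by (simp_all only: insert_subset insert_iff) (blast+)
  with a b pn show ?thesis by (intro that[of a b p]) auto
qed

section \<open>Coordinates and parity of lifted elements\<close>

lemma of_int_bit_eq_iff: "(of_int a :: bit) = of_int b \<longleftrightarrow> even (a - b)"
proof -
  have *: "(of_int c :: bit) = 0 \<longleftrightarrow> even c" for c
    by (cases "even c") (auto elim!: evenE oddE)
  have "(of_int a :: bit) = of_int b \<longleftrightarrow> (of_int (a - b) :: bit) = 0"
    by (simp only: of_int_diff right_minus_eq)
  then show ?thesis by (simp only: *)
qed

lemma val_simps [simp]:
  "val (x + y) = val x + val y" "val (x - y) = val x - val y" "val 0 = 0"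
  by (simp_all add: val_def)

lemma cls_simps [simp]:
  "cls (x + y) = cls x + cls y" "cls (x - y) = cls x + cls y" "cls 0 = 0"
  by (simp_all add: cls_def prod_eq_iff)

lemma even_val_diff: "cls x = cls y \<Longrightarrow> even (val x - val y)"
  by (auto simp: cls_def of_int_bit_eq_iff)

lemma even_val: "cls x = 0 \<Longrightarrow> even (val x)"
  using even_val_diff[of x 0] by simp

lemma cls_sum_mset_eq_0: "\<forall>d \<in># D. cls d = 0 \<Longrightarrow> cls (sum_mset D) = 0"
  by (induction D) auto

section \<open>Counting the subsums of blocks of class 0\<close>

lemma zfree_subset: "zfree n T \<Longrightarrow> S \<subseteq># T \<Longrightarrow> zfree n S"
  unfolding zfree_def by (blast intro: subset_mset.order_trans)

text \<open>A new element must enlarge the set of residues: otherwise translation by it permutes that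
  set, and some subsum is the negative of the new element.\<close>

lemma card_residues:
  assumes "n \<ge> 1" "\<forall>d \<in># D. cls d = 0" "zfree n D"
  shows "card ((\<lambda>S. val (sum_mset S) mod (2 * int n)) ` {S. S \<subseteq># D}) \<ge> size D + 1"
  using assms(2,3)
proof (induction D)
  case empty
  then show ?case by simp
next
  case (add d D)
  let ?N = "2 * int n"
  define R where "R D = (\<lambda>S. val (sum_mset S) mod ?N) ` {S. S \<subseteq># D}" for D
  define f where "f r = (r + val d) mod ?N" for r
  have fin: "finite (R D)" for D
  proof (rule finite_subset)
    show "R D \<subseteq> {0..<?N}" using \<open>n \<ge> 1\<close> by (simp add: R_def image_subset_iff)
  qed simp
  have IH: "card (R D) \<ge> size D + 1"
    using add zfree_subset[of n "add_mset d D" D] by (simp add: R_def)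
  have "R D \<subseteq> R (add_mset d D)"
    unfolding R_def
    by (intro image_mono Collect_mono)
      (metis add_mset_add_single mset_subset_eq_add_left subset_mset.order_trans)
  moreover have "R D \<noteq> R (add_mset d D)"
  proof
    assume eq: "R D = R (add_mset d D)"
    have "f ` R D \<subseteq> R D"
    proof
      fix y assume "y \<in> f ` R D"
      then obtain S where S: "S \<subseteq># D" "y = f (val (sum_mset S) mod ?N)"
        by (auto simp: R_def)
      have "y = val (sum_mset (add_mset d S)) mod ?N"
        by (simp add: S(2) f_def mod_simps add.commute)
      with S(1) have "y \<in> R (add_mset d D)"
        unfolding R_def by (auto intro!: image_eqI[of _ _ "add_mset d S"])
      then show "y \<in> R D" by (simp add: eq)
    qed
    moreover have "inj_on f (R D)"
    proof (rule inj_onI)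
      fix x y assume xy: "x \<in> R D" "y \<in> R D" "f x = f y"
      then have "x mod ?N = y mod ?N"
        unfolding f_def by (metis add_diff_cancel_right' mod_diff_left_eq)
      moreover have "x mod ?N = x" "y mod ?N = y"
        using xy by (auto simp: R_def)
      ultimately show "x = y" by simp
    qed
    ultimately have "f ` R D = R D"
      using fin by (simp add: endo_inj_surj)
    moreover have "0 \<in> R D"
      unfolding R_def by (auto intro!: image_eqI[of _ _ "{#}"])
    ultimately obtain r where "r \<in> R D" "f r = 0" by (metis imageE)
    then obtain S where S: "S \<subseteq># D" and r: "r = val (sum_mset S) mod ?N"
      by (auto simp: R_def)
    have "(val (sum_mset S) + val d) mod ?N = 0"
      using \<open>f r = 0\<close> unfolding f_def r by (simp only: mod_add_left_eq)
    have "null n (sum_mset (add_mset d S))"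
      using S \<open>_ mod ?N = 0\<close> add.prems(1) cls_sum_mset_eq_0[of "add_mset d S"]
        mset_subset_eqD[of S D]
      by (auto simp: null_def add.commute)
    then show False
      using add.prems(2) S unfolding zfree_def by (metis add_mset_not_empty mset_subset_eq_add_mset_cancel)
  qed
  ultimately have "card (R D) < card (R (add_mset d D))"
    by (intro psubset_card_mono fin) auto
  with IH show ?case by (simp add: R_def)
qed

text \<open>The residues of the subsums of \<open>D\<close>, at least \<open>size D + 1\<close> in
  number, and the missed residues are disjoint sets of even residues modulo \<open>2 * n\<close>, of
  which there are only \<open>n\<close>. The four lemmas of the context below take 0, 1, 2 and 3
  missed residues.\<close>

lemma size_plus_card_not_hits_less:
  assumes "n \<ge> 1" "\<forall>d \<in># D. cls d = 0" "zfree n D"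
    and X: "finite X" "\<And>x. x \<in> X \<Longrightarrow> even x \<and> \<not> hits n D x"
      "inj_on (\<lambda>x. x mod (2 * int n)) X"
  shows "size D + card X < n"
proof -
  let ?N = "2 * int n"
  let ?R = "(\<lambda>S. val (sum_mset S) mod ?N) ` {S. S \<subseteq># D}"
  let ?Y = "(\<lambda>x. x mod ?N) ` X"
  let ?E = "(\<lambda>k. 2 * k) ` {0..<int n}"
  have even_mod: "y mod ?N \<in> ?E" if "even y" for y
  proof -
    from that have "even (y mod ?N)" by (simp add: dvd_mod)
    then obtain k where k: "y mod ?N = 2 * k" by blast
    have "0 \<le> y mod ?N" "y mod ?N < ?N" using \<open>n \<ge> 1\<close> by simp_all
    then show ?thesis using k by auto
  qed
  have "?R \<subseteq> ?E"
  proof clarify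
    fix S assume "S \<subseteq># D"
    then have "cls (sum_mset S) = 0"
      using assms(2) by (intro cls_sum_mset_eq_0) (auto dest: mset_subset_eqD)
    then show "val (sum_mset S) mod ?N \<in> ?E"
      by (intro even_mod even_val)
  qed
  moreover have "?Y \<subseteq> ?E" using X(2) even_mod by blast
  ultimately have sub: "?R \<union> ?Y \<subseteq> ?E" by blast
  have disj: "?R \<inter> ?Y = {}"
    using X(2) by (auto simp: hits_def mod_eq_dvd_iff)
  have finR: "finite ?R" using \<open>?R \<subseteq> ?E\<close> by (rule finite_subset) simp
  have "card ?R + card ?Y = card (?R \<union> ?Y)"
    using finR X(1) disj by (subst card_Un_disjoint) auto
  also have "\<dots> \<le> card ?E" using sub by (intro card_mono) auto
  also have "card ?E = n" by (simp add: card_image inj_on_def)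
  finally have "card ?R + card ?Y \<le> n" .
  moreover have "card ?Y = card X" using X(3) by (rule card_image)
  moreover have "card ?R \<ge> size D + 1" using assms by (intro card_residues)
  ultimately show ?thesis by linarith
qed

context
  fixes n :: nat and D :: "elt multiset"
  assumes n: "n \<ge> 1" and D: "\<forall>d \<in># D. cls d = 0" and free: "zfree n D"
begin

lemma size_zfree_less: "size D < n"
  using size_plus_card_not_hits_less[OF n D free, of "{}"] by simp

lemma hits_if_size: "size D + 1 \<ge> n \<Longrightarrow> even x \<Longrightarrow> hits n D x"
  using size_plus_card_not_hits_less[OF n D free, of "{x}"] by auto

lemma not_hits_unique:
  assumes "size D + 2 \<ge> n" "even x" "even y" "\<not> hits n D x" "\<not> hits n D y"
  shows "2 * int n dvd x - y"
proof (rule ccontr)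
  assume "\<not> ?thesis"
  then have "x mod (2 * int n) \<noteq> y mod (2 * int n)" by (simp add: mod_eq_dvd_iff)
  moreover from this have "x \<noteq> y" by auto
  ultimately show False
    using size_plus_card_not_hits_less[OF n D free, of "{x, y}"] assms by auto
qed

lemma not_hits_three:
  assumes "size D + 3 \<ge> n" "even x" "even y" "even z"
    and "\<not> hits n D x" "\<not> hits n D y" "\<not> hits n D z"
  shows "2 * int n dvd x - y \<or> 2 * int n dvd x - z \<or> 2 * int n dvd y - z"
proof (rule ccontr)
  assume "\<not> ?thesis"
  then have "x mod (2 * int n) \<noteq> y mod (2 * int n)" "x mod (2 * int n) \<noteq> z mod (2 * int n)"
    "y mod (2 * int n) \<noteq> z mod (2 * int n)" by (simp_all add: mod_eq_dvd_iff)
  moreover from this have "x \<noteq> y" "x \<noteq> z" "y \<noteq> z" by auto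
  ultimately show False
    using size_plus_card_not_hits_less[OF n D free, of "{x, y, z}"] assms by auto
qed

end

section \<open>Reached elements and missed residues\<close>

lemma reach_if_hits:
  assumes "D + W \<subseteq># T" "\<forall>d \<in># D. cls d = 0"
    and "cls g = cls (sum_mset W)" "hits n D (val g - val (sum_mset W))"
  shows "reach n T g"
proof -
  obtain S where S: "S \<subseteq># D" "2 * int n dvd val (sum_mset S) - (val g - val (sum_mset W))"
    using assms(4) by (auto simp: hits_def)
  have "cls (sum_mset S) = 0"
    using assms(2) S(1) by (intro cls_sum_mset_eq_0) (auto dest: mset_subset_eqD)
  then have "null n (sum_mset (S + W) - g)"
    using S(2) assms(3) by (simp add: null_def algebra_simps)
  moreover have "S + W \<subseteq># T"
    using S(1) assms(1) by (meson mset_subset_eq_mono_add subset_mset.order_refl subset_mset.order_trans)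
  ultimately show ?thesis unfolding reach_def by blast
qed

text \<open>A subsum of \<open>D\<close> with this value would cancel \<open>W\<close> and give a
  nonempty subsequence with sum in the kernel. This is the source of missed residues.\<close>

lemma not_hits_uminus:
  assumes "zfree n T" "D + W \<subseteq># T" "\<forall>d \<in># D. cls d = 0" "W \<noteq> {#}"
    "cls (sum_mset W) = 0"
  shows "\<not> hits n D (- val (sum_mset W))"
proof
  assume "hits n D (- val (sum_mset W))"
  then obtain S where S: "S \<subseteq># D" "2 * int n dvd val (sum_mset S) + val (sum_mset W)"
    by (auto simp: hits_def)
  have "cls (sum_mset S) = 0"
    using assms(3) S(1) by (intro cls_sum_mset_eq_0) (auto dest: mset_subset_eqD)
  then have "null n (sum_mset (S + W))"
    using S(2) assms(5) by (simp add: null_def algebra_simps)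
  moreover have "S + W \<subseteq># T"
    using S(1) assms(2) by (meson mset_subset_eq_mono_add subset_mset.order_refl subset_mset.order_trans)
  ultimately show False using assms(1,4) unfolding zfree_def by (metis union_eq_empty)
qed

lemma hits_0: "2 * int n dvd x \<Longrightarrow> hits n D x"
  unfolding hits_def by (rule exI[of _ "{#}"]) simp

section \<open>Two points, and a Fano line with a point\<close>

lemma dvd_lincomb:
  fixes N :: int
  assumes "N dvd x" "N dvd y" "z = i * x + j * y"
  shows "N dvd z"
  using assms by simp

lemma dvd_lincomb3:
  fixes N :: int
  assumes "N dvd x" "N dvd y" "N dvd w" "z = i * x + j * y + k * w"
  shows "N dvd z"
  using assms by simp

lemmas mset_ac = add_mset_commute union_mset_add_mset_left add_0

lemma subset_mset_left: "D + U \<subseteq># T \<Longrightarrow> W + W' = U \<Longrightarrow> D + W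
  \<subseteq># T"
  by (metis add.assoc mset_subset_eq_add_left subset_mset.order_trans)

lemma covered_if_hits:
  assumes "D + W \<subseteq># T" "\<forall>d \<in># D. cls d = 0" "v = cls (sum_mset W)"
    and "\<And>x. even x \<Longrightarrow> hits n D x"
  shows "covered n T v"
  unfolding covered_def
proof (intro allI impI)
  fix g assume "cls g = v"
  with assms show "reach n T g"
    by (intro reach_if_hits[of D W]) (auto intro: even_val_diff)
qed

text \<open>With \<open>n - 1\<close> blocks no even residue is missed, so every class of a subsum
  of \<open>x, y\<close> is covered, and these classes form a plane.\<close>

lemma good_if_full:
  assumes "n \<ge> 1" "zfree n T" "D + {#x, y#} \<subseteq># T" "\<forall>d \<in># D. cls d = 0"
    "size D + 1 \<ge> n"
    and "cls x \<noteq> 0" "cls y \<noteq> 0" "cls x \<noteq> cls y"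
  shows "good n T"
proof -
  note sub = subset_mset_left[OF assms(3)]
  have D: "zfree n D" using zfree_subset[OF assms(2) sub[of "{#}"]] by simp
  have hits: "hits n D z" if "even z" for z
    using hits_if_size[OF assms(1,4) D assms(5) that] .
  have "covered n T 0" by (rule covered_if_hits[OF sub[of "{#}" "{#x,y#}"] assms(4)]) (simp_all add: hits)
  moreover have "covered n T (cls x)" by (rule covered_if_hits[OF sub[of "{#x#}" "{#y#}"] assms(4)])
    (simp_all add: hits)
  moreover have "covered n T (cls y)" by (rule covered_if_hits[OF sub[of "{#y#}" "{#x#}"] assms(4)])
    (simp_all add: hits add_mset_commute)
  moreover have "covered n T (cls x + cls y)" by
    (rule covered_if_hits[OF sub[of "{#x,y#}" "{#}"] assms(4)]) (simp_all add: hits)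
  ultimately show ?thesis unfolding good_def using assms(6-8) by blast
qed

text \<open>With at least \<open>n - 2\<close> blocks at most one residue is missed, and the line
  yields the missed residue \<open>- ?l\<close>. Hence an unreached element differs by
  \<open>- ?l\<close> from every representation of its class, and two representations give a
  congruence. The covered plane is spanned by \<open>q\<close> and a suitable point of the
  line.\<close>

lemma good_line_point:
  assumes "n \<ge> 1" "zfree n T" "D + {#q, a, b, c#} \<subseteq># T" "\<forall>d \<in># D. cls d = 0"
    "size D + 2 \<ge> n"
    and line: "cls a + cls b = cls c" "cls a \<noteq> 0" "cls b \<noteq> 0" "cls c \<noteq> 0"
    and q: "cls q \<notin> {0, cls a, cls b, cls c}"
  shows "good n T"
proof -
  let ?N = "2 * int n"
  let ?l = "val a + val b + val c"
  note sub = subset_mset_left[OF assms(3)]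
  have D: "zfree n D" using zfree_subset[OF assms(2) sub[of "{#}"]] by simp
  have line': "cls b + cls c = cls a" "cls a + cls c = cls b"
    unfolding line(1)[symmetric] by (simp_all add: ac_simps)
  have nl: "\<not> hits n D (- ?l)"
    using not_hits_uminus[OF assms(2) sub[of "{#a,b,c#}" "{#q#}"] assms(4)] line'
    by (simp add: algebra_simps)
  have el: "even ?l" using even_val[of "a + b + c"] line by simp
  have nl0: "\<not> ?N dvd ?l" using nl hits_0[of n "- ?l" D] by (metis dvd_minus_iff)
  have uniq: "?N dvd x + ?l" if "even x" "\<not> hits n D x" for x
  proof -
    have "even (- ?l)" using el by (simp only: dvd_minus_iff)
    from not_hits_unique[OF assms(1,4) D assms(5) that(1) this that(2) nl]
    show ?thesis by (simp only: diff_minus_eq_add)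
  qed
  have unc: "?N dvd val g - val (sum_mset W) + ?l"
    if "cls g = cls (sum_mset W)" "\<not> reach n T g" "W + W' = {#q,a,b,c#}" for g W W'
  proof (rule uniq)
    show "even (val g - val (sum_mset W))" using even_val_diff that(1) .
    show "\<not> hits n D (val g - val (sum_mset W))"
      using reach_if_hits[OF sub[OF that(3)] assms(4) that(1)] that(2) by blast
  qed
  \<comment> \<open>\<open>bad x\<close> is the congruence forced when \<open>cls x\<close> or
    \<open>cls q + cls x\<close> is uncovered: \<open>x\<close> can be exchanged for
    \<open>y + z\<close> without changing the class.\<close>
  define bad where "bad x \<longleftrightarrow> ?N dvd 2 * val x - ?l" for x
  have cov: "covered n T (cls x) \<and> covered n T (cls q + cls x)"
    if abc: "{#x, y, z#} = {#a, b, c#}" and yz: "cls y + cls z = cls x" and nbad: "\<not> bad x" for x y z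
  proof -
    have X: "{#q,x,y,z#} = {#q,a,b,c#}" by (simp only: abc)
    have "val (sum_mset {#x,y,z#}) = val (sum_mset {#a,b,c#})" by (simp only: abc)
    then have vl: "val x + val y + val z = ?l" by simp
    have "reach n T g" if g: "cls g = cls x" for g
    proof (rule ccontr)
      assume neg: "\<not> reach n T g"
      have "?N dvd val g - val (sum_mset {#x#}) + ?l"
        by (rule unc[OF _ neg, of _ "{#y,z,q#}"], simp add: g) (unfold X[symmetric], simp only: mset_ac)
      moreover have "?N dvd val g - val (sum_mset {#y,z#}) + ?l"
        by (rule unc[OF _ neg, of _ "{#x,q#}"], simp add: g yz) (unfold X[symmetric], simp only: mset_ac)
      ultimately have "bad x" unfolding bad_def
        by (rule dvd_lincomb[where i = "-1" and j = 1]) (use vl in simp)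
      with nbad show False ..
    qed
    moreover have "reach n T g" if g: "cls g = cls q + cls x" for g
    proof (rule ccontr)
      assume neg: "\<not> reach n T g"
      have "?N dvd val g - val (sum_mset {#q,x#}) + ?l"
        by (rule unc[OF _ neg, of _ "{#y,z#}"], simp add: g) (unfold X[symmetric], simp only: mset_ac)
      moreover have "?N dvd val g - val (sum_mset {#q,y,z#}) + ?l"
        by (rule unc[OF _ neg, of _ "{#x#}"], simp add: g yz) (unfold X[symmetric], simp only: mset_ac)
      ultimately have "bad x" unfolding bad_def
        by (rule dvd_lincomb[where i = "-1" and j = 1]) (use vl in simp)
      with nbad show False ..
    qed
    ultimately show ?thesis unfolding covered_def by blast
  qed
  \<comment> \<open>Adding the whole line keeps the class of \<open>W\<close> but shifts its value
    by \<open>?l\<close>; if the class were uncovered, \<open>?l\<close> would vanish modulo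
    \<open>?N\<close>.\<close>
  have cov0: "covered n T (cls (sum_mset W))" if "W + W' = {#q#}" for W W'
    unfolding covered_def
  proof (intro allI impI, rule ccontr)
    have rc: "X + Y + Z = X + Z + Y" for X Y Z :: "elt multiset" by (metis add.assoc add.commute)
    fix g assume g: "cls g = cls (sum_mset W)" and neg: "\<not> reach n T g"
    have "?N dvd val g - val (sum_mset W) + ?l"
      by (rule unc[OF g neg, of "W' + {#a,b,c#}"]) (unfold add.assoc[symmetric] that, simp only: mset_ac)
    moreover have "?N dvd val g - val (sum_mset (W + {#a,b,c#})) + ?l"
      by (rule unc[OF _ neg, of _ W'], simp add: g line line')
        (unfold rc[of W _ W'] that, simp only: mset_ac)
    ultimately have "?N dvd ?l"
      by (rule dvd_lincomb[where i = 1 and j = "-1"]) simp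
    with nl0 show False ..
  qed
  \<comment> \<open>The three congruences add up to \<open>2 * ?l = 3 * ?l\<close> modulo
    \<open>?N\<close>.\<close>
  have "\<not> (bad a \<and> bad b \<and> bad c)"
  proof
    assume "bad a \<and> bad b \<and> bad c"
    then have "bad a" "bad b" "bad c" by simp_all
    then have "?N dvd ?l" unfolding bad_def
      by (rule dvd_lincomb3[where i = "-1" and j = "-1" and k = "-1"]) simp
    with nl0 show False ..
  qed
  then obtain x where x: "x \<in> {a, b, c}" "covered n T (cls x)" "covered n T (cls q + cls x)"
  proof -
    assume *: "\<not> (bad a \<and> bad b \<and> bad c)"
    have 1: "{#b, a, c#} = {#a, b, c#}" "{#c, a, b#} = {#a, b, c#}"
      by (simp_all only: mset_ac)
    from * that[OF _ cov[OF refl line'(1), THEN conjunct1] cov[OF refl line'(1), THEN conjunct2]]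
      that[OF _ cov[OF 1(1) line'(2), THEN conjunct1] cov[OF 1(1) line'(2), THEN conjunct2]]
      that[OF _ cov[OF 1(2) line(1), THEN conjunct1] cov[OF 1(2) line(1), THEN conjunct2]]
    show ?thesis by blast
  qed
  moreover have "covered n T 0" "covered n T (cls q)"
    using cov0[of "{#}"] cov0[of "{#q#}" "{#}"] by simp_all
  ultimately show ?thesis
    unfolding good_def using q line by (intro exI[of _ "cls q"] exI[of _ "cls x"]) auto
qed

section \<open>Six points\<close>

text \<open>With at least \<open>n - 3\<close> blocks, the missed residues \<open>x\<close>,
  \<open>x - y\<close> and \<open>- y\<close>, coming from \<open>W\<close>, \<open>W + B\<close>
  and \<open>B\<close>, are not pairwise distinct. As 0 is never missed, the only possible
  coincidence is \<open>x = - y\<close>; then the missed residue \<open>x - y\<close> is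
  \<open>- 2 * y\<close>, which is therefore nonzero.\<close>

lemma not_reach_block:
  assumes "n \<ge> 1" "zfree n T" "D + U \<subseteq># T" "\<forall>d \<in># D. cls d = 0" "size D + 3 \<ge> n"
    and U: "W + B + R = U" and B: "B \<noteq> {#}" "cls (sum_mset B) = 0"
    and g: "cls g = cls (sum_mset W)" "\<not> reach n T g"
  shows "2 * int n dvd val g - val (sum_mset W) + val (sum_mset B)"
    and "\<not> 2 * int n dvd 2 * val (sum_mset B)"
proof -
  let ?N = "2 * int n"
  define x where "x = val g - val (sum_mset W)"
  define y where "y = val (sum_mset B)"
  note sub = subset_mset_left[OF assms(3)]
  have D: "zfree n D" using zfree_subset[OF assms(2) sub[of "{#}"]] by simp
  have "W + (B + R) = U" "(W + B) + R = U" "B + (W + R) = U"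
    using U by (simp_all only: ac_simps)
  note sub' = this[THEN sub]
  have "\<not> hits n D x"
    using reach_if_hits[OF sub'(1) assms(4) g(1)] g(2) by (auto simp: x_def)
  moreover have "\<not> hits n D (x - y)"
    using reach_if_hits[OF sub'(2) assms(4), of g n] g B by (auto simp: x_def y_def diff_diff_eq)
  moreover have y: "\<not> hits n D (- y)"
    using not_hits_uminus[OF assms(2) sub'(3) assms(4) B] by (simp add: y_def)
  moreover have "even x" using even_val_diff[OF g(1)] by (simp only: x_def)
  moreover have "even y" using even_val[OF B(2)] by (simp only: y_def)
  ultimately have "?N dvd x - (x - y) \<or> ?N dvd x - - y \<or> ?N dvd (x - y) - - y"
    by (intro not_hits_three[OF assms(1,4) D assms(5)]) auto
  moreover have "\<not> ?N dvd x" using \<open>\<not> hits n D x\<close> hits_0 by blast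
  moreover have "\<not> ?N dvd - y" using y hits_0 by blast
  ultimately have xy: "?N dvd x + y" by simp
  then show "?N dvd val g - val (sum_mset W) + val (sum_mset B)" by (simp add: x_def y_def)
  have "\<not> ?N dvd x - y" using \<open>\<not> hits n D (x - y)\<close> hits_0 by blast
  then show "\<not> ?N dvd 2 * val (sum_mset B)"
    using dvd_lincomb[OF xy, of "2 * y" "x - y" 1 "-1"] by (auto simp: y_def)
qed

text \<open>The pairs \<open>a, a'\<close>, \<open>b, b'\<close> and \<open>c, c'\<close> lie on the
  three lines through \<open>p\<close>. If no plane is covered, every uncovered class relates the
  sums of blocks disjoint from its representations, until a block sum or its double is forced to
  vanish.\<close>

lemma good_six:
  assumes "n \<ge> 1" "zfree n T" "D + {#a, a', b, b', c, c'#} \<subseteq># T"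
    "\<forall>d \<in># D. cls d = 0" "size D + 3 \<ge> n"
    and cl: "cls a' = cls a + p" "cls b' = cls b + p" "cls c = cls a + cls b" "cls c' = cls a + cls b + p"
    and ne: "cls a \<noteq> 0" "cls b \<noteq> 0" "cls a \<noteq> cls b"
      "p \<notin> {0, cls a, cls b, cls a + cls b}"
  shows "good n T"
proof (rule ccontr)
  assume bad: "\<not> good n T"
  let ?N = "2 * int n" and ?U = "{#a, a', b, b', c, c'#}"
  note sub = subset_mset_left[OF assms(3)]
  \<comment> \<open>\<open>l0\<close> to \<open>l3\<close> belong to the lines missing \<open>p\<close>, \<open>sa\<close> to \<open>sc\<close> to the other blocks with sum in \<open>2G\<close>; everything hinges
    on the identity \<open>l0 + l1 + l2 + l3 = sa + sb + sc\<close>.\<close>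
  define l0 where "l0 = val a + val b + val c"
  define l1 where "l1 = val a + val b' + val c'"
  define l2 where "l2 = val a' + val b + val c'"
  define l3 where "l3 = val a' + val b' + val c"
  define sa where "sa = val b + val b' + val c + val c'"
  define sb where "sb = val a + val a' + val c + val c'"
  define sc where "sc = val a + val a' + val b + val b'"
  note defs = l0_def l1_def l2_def l3_def sa_def sb_def sc_def
  have cube: "v + w + v = (w :: bit \<times> bit \<times> bit)" "v + w + (v + z) = w + z" "v + (w + v) = w" 
    "v + (w + (v + z)) = w + z" for v w z :: "bit \<times> bit \<times> bit"
    by (simp_all add: ac_simps)
  note clsimps = cl cube ac_simps
  have block: "\<not> ?N dvd val (sum_mset B)" if "B + R = ?U" "B \<noteq> {#}" "cls (sum_mset B) = 0" for B R
  proof -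
    have "D + B \<subseteq># T" using sub that(1) by blast
    from not_hits_uminus[OF assms(2) this assms(4) that(2,3)] hits_0[of n "- val (sum_mset B)" D]
    show ?thesis by (metis dvd_minus_iff)
  qed
  have l: "\<not> ?N dvd l0" "\<not> ?N dvd l1" "\<not> ?N dvd l2" "\<not> ?N dvd l3"
    using block[of "{#a,b,c#}" "{#a',b',c'#}"] block[of "{#a,b',c'#}" "{#a',b,c#}"]
      block[of "{#a',b,c'#}" "{#a,b',c#}"] block[of "{#a',b',c#}" "{#a,b,c'#}"]
    by (simp_all only: mset_ac) (simp_all add: clsimps defs)
  \<comment> \<open>An unreached element of class \<open>v\<close> is measured against two
    representations, each with a disjoint block; eliminating the element relates the four
    sums.\<close>
  have eq: "?N dvd (val (sum_mset W') - val (sum_mset B')) - (val (sum_mset W) - val (sum_mset B))"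
    and dbl: "\<not> ?N dvd 2 * val (sum_mset B)"
    if "\<not> covered n T v" "W + B + R = ?U" "W' + B' + R' = ?U" "B \<noteq> {#}" "B' \<noteq> {#}"
      "cls (sum_mset B) = 0" "cls (sum_mset B') = 0" "cls (sum_mset W) = v" "cls (sum_mset W') = v"
    for v W B R W' B' R'
  proof -
    from that(1) obtain g where g: "cls g = v" "\<not> reach n T g" by (auto simp: covered_def)
    note nr = not_reach_block[OF assms(1-5)]
    have "?N dvd val g - val (sum_mset W) + val (sum_mset B)"
      by (rule nr[OF that(2,4,6)]) (use g that in simp_all)
    moreover have "?N dvd val g - val (sum_mset W') + val (sum_mset B')"
      by (rule nr[OF that(3,5,7)]) (use g that in simp_all)
    ultimately show "?N dvd (val (sum_mset W') - val (sum_mset B')) - (val (sum_mset W) - val (sum_mset B))"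
      by (rule dvd_lincomb[where i = 1 and j = "-1"]) simp
    show "\<not> ?N dvd 2 * val (sum_mset B)"
      by (rule nr[OF that(2,4,6)]) (use g that in simp_all)
  qed
  \<comment> \<open>\<open>l2\<close>, \<open>l3\<close> and \<open>sa\<close> are the sums of
    blocks avoiding \<open>a\<close>; taking \<open>{#a#}\<close> as representation each time, they
    must agree. The next five facts are analogous.\<close>
  have unc_a: "?N dvd l2 - l3" "?N dvd l2 - sa" if "\<not> covered n T (cls a)"
    using eq[OF that, of "{#a#}" "{#a',b,c'#}" "{#b',c#}" "{#a#}" "{#a',b',c#}" "{#b,c'#}"]
      eq[OF that, of "{#a#}" "{#a',b,c'#}" "{#b',c#}" "{#a#}" "{#b,b',c,c'#}" "{#a'#}"]
    by (simp_all only: mset_ac) (simp_all add: clsimps defs algebra_simps)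
  have unc_a': "?N dvd l0 - l1" "?N dvd l0 - sa" if "\<not> covered n T (cls a')"
    using eq[OF that, of "{#a'#}" "{#a,b,c#}" "{#b',c'#}" "{#a'#}" "{#a,b',c'#}" "{#b,c#}"]
      eq[OF that, of "{#a'#}" "{#a,b,c#}" "{#b',c'#}" "{#a'#}" "{#b,b',c,c'#}" "{#a#}"]
    by (simp_all only: mset_ac) (simp_all add: clsimps defs algebra_simps)
  have unc_b: "?N dvd l1 - l3" "?N dvd l1 - sb" if "\<not> covered n T (cls b)"
    using eq[OF that, of "{#b#}" "{#a,b',c'#}" "{#a',c#}" "{#b#}" "{#a',b',c#}" "{#a,c'#}"]
      eq[OF that, of "{#b#}" "{#a,b',c'#}" "{#a',c#}" "{#b#}" "{#a,a',c,c'#}" "{#b'#}"]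
    by (simp_all only: mset_ac) (simp_all add: clsimps defs algebra_simps)
  have unc_b': "?N dvd l0 - l2" "?N dvd l0 - sb" if "\<not> covered n T (cls b')"
    using eq[OF that, of "{#b'#}" "{#a,b,c#}" "{#a',c'#}" "{#b'#}" "{#a',b,c'#}" "{#a,c#}"]
      eq[OF that, of "{#b'#}" "{#a,b,c#}" "{#a',c'#}" "{#b'#}" "{#a,a',c,c'#}" "{#b#}"]
    by (simp_all only: mset_ac) (simp_all add: clsimps defs algebra_simps)
  have unc_c: "?N dvd l1 - l2" "?N dvd l1 - sc" if "\<not> covered n T (cls c)"
    using eq[OF that, of "{#c#}" "{#a,b',c'#}" "{#a',b#}" "{#c#}" "{#a',b,c'#}" "{#a,b'#}"]
      eq[OF that, of "{#c#}" "{#a,b',c'#}" "{#a',b#}" "{#c#}" "{#a,a',b,b'#}" "{#c'#}"]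
    by (simp_all only: mset_ac) (simp_all add: clsimps defs algebra_simps)
  have unc_c': "?N dvd l0 - l3" "?N dvd l0 - sc" if "\<not> covered n T (cls c')"
    using eq[OF that, of "{#c'#}" "{#a,b,c#}" "{#a',b'#}" "{#c'#}" "{#a',b',c#}" "{#a,b#}"]
      eq[OF that, of "{#c'#}" "{#a,b,c#}" "{#a',b'#}" "{#c'#}" "{#a,a',b,b'#}" "{#c#}"]
    by (simp_all only: mset_ac) (simp_all add: clsimps defs algebra_simps)
  have sum: "l0 + l1 + l2 + l3 = sa + sb + sc" by (simp add: defs)
  \<comment> \<open>With the empty representation of 0 all seven block sums agree, and the identity
    reads \<open>4 * l0 = 3 * l0\<close>.\<close>
  have "covered n T 0"
  proof (rule ccontr)
    assume that: "\<not> covered n T 0"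
    have l1: "?N dvd l0 - l1"
      using eq[OF that, of "{#}" "{#a,b,c#}" "{#a',b',c'#}" "{#}" "{#a,b',c'#}" "{#a',b,c#}"]
      by (simp_all only: mset_ac) (simp_all add: clsimps defs algebra_simps)
    have l2: "?N dvd l0 - l2"
      using eq[OF that, of "{#}" "{#a,b,c#}" "{#a',b',c'#}" "{#}" "{#a',b,c'#}" "{#a,b',c#}"]
      by (simp_all only: mset_ac) (simp_all add: clsimps defs algebra_simps)
    have l3: "?N dvd l0 - l3"
      using eq[OF that, of "{#}" "{#a,b,c#}" "{#a',b',c'#}" "{#}" "{#a',b',c#}" "{#a,b,c'#}"]
      by (simp_all only: mset_ac) (simp_all add: clsimps defs algebra_simps)
    have sa: "?N dvd l0 - sa"
      using eq[OF that, of "{#}" "{#a,b,c#}" "{#a',b',c'#}" "{#}" "{#b,b',c,c'#}" "{#a,a'#}"]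
      by (simp_all only: mset_ac) (simp_all add: clsimps defs algebra_simps)
    have sb: "?N dvd l0 - sb"
      using eq[OF that, of "{#}" "{#a,b,c#}" "{#a',b',c'#}" "{#}" "{#a,a',c,c'#}" "{#b,b'#}"]
      by (simp_all only: mset_ac) (simp_all add: clsimps defs algebra_simps)
    have sc: "?N dvd l0 - sc"
      using eq[OF that, of "{#}" "{#a,b,c#}" "{#a',b',c'#}" "{#}" "{#a,a',b,b'#}" "{#c,c'#}"]
      by (simp_all only: mset_ac) (simp_all add: clsimps defs algebra_simps)
    have "?N dvd (l0 - l1) + (l0 - l2) + (l0 - l3) - (l0 - sa) - (l0 - sb) - (l0 - sc)"
      by (intro dvd_add dvd_diff l1 l2 l3 sa sb sc)
    also have "\<dots> = l0" using sum by simp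
    finally show False using l(1) by contradiction
  qed
  \<comment> \<open>All six elements together have class \<open>p\<close>, so the complement of
    every block represents \<open>p\<close>. This gives the doubled congruences, hence
    \<open>2 * l0 = 0\<close>, which \<open>dbl\<close> excludes.\<close>
  have "covered n T p"
  proof (rule ccontr)
    assume that: "\<not> covered n T p"
    have l1: "?N dvd 2 * l0 - 2 * l1"
      using eq[OF that, of "{#a',b',c'#}" "{#a,b,c#}" "{#}" "{#a',b,c#}" "{#a,b',c'#}" "{#}"]
      by (simp_all only: mset_ac) (simp_all add: clsimps defs algebra_simps)
    have l2: "?N dvd 2 * l0 - 2 * l2"
      using eq[OF that, of "{#a',b',c'#}" "{#a,b,c#}" "{#}" "{#a,b',c#}" "{#a',b,c'#}" "{#}"]
      by (simp_all only: mset_ac) (simp_all add: clsimps defs algebra_simps)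
    have l3: "?N dvd 2 * l0 - 2 * l3"
      using eq[OF that, of "{#a',b',c'#}" "{#a,b,c#}" "{#}" "{#a,b,c'#}" "{#a',b',c#}" "{#}"]
      by (simp_all only: mset_ac) (simp_all add: clsimps defs algebra_simps)
    have sa: "?N dvd 2 * l0 - 2 * sa"
      using eq[OF that, of "{#a',b',c'#}" "{#a,b,c#}" "{#}" "{#a,a'#}" "{#b,b',c,c'#}" "{#}"]
      by (simp_all only: mset_ac) (simp_all add: clsimps defs algebra_simps)
    have sb: "?N dvd 2 * l0 - 2 * sb"
      using eq[OF that, of "{#a',b',c'#}" "{#a,b,c#}" "{#}" "{#b,b'#}" "{#a,a',c,c'#}" "{#}"]
      by (simp_all only: mset_ac) (simp_all add: clsimps defs algebra_simps)
    have sc: "?N dvd 2 * l0 - 2 * sc"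
      using eq[OF that, of "{#a',b',c'#}" "{#a,b,c#}" "{#}" "{#c,c'#}" "{#a,a',b,b'#}" "{#}"]
      by (simp_all only: mset_ac) (simp_all add: clsimps defs algebra_simps)
    have "?N dvd (2 * l0 - 2 * l1) + (2 * l0 - 2 * l2) + (2 * l0 - 2 * l3)
        - (2 * l0 - 2 * sa) - (2 * l0 - 2 * sb) - (2 * l0 - 2 * sc)"
      by (intro dvd_add dvd_diff l1 l2 l3 sa sb sc)
    also have "\<dots> = 2 * l0" using sum by simp
    finally have "?N dvd 2 * l0" .
    moreover have "\<not> ?N dvd 2 * l0"
      using dbl[OF that, of "{#a',b',c'#}" "{#a,b,c#}" "{#}" "{#a',b,c#}" "{#a,b',c'#}" "{#}"]
      by (simp_all only: mset_ac) (simp_all add: clsimps defs algebra_simps)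
    ultimately show False by contradiction
  qed
  have plane: "\<not> covered n T v \<or> \<not> covered n T w \<or> \<not> covered n T (v + w)"
    if "v \<noteq> 0" "w \<noteq> 0" "v \<noteq> w" for v w
    using bad that \<open>covered n T 0\<close> unfolding good_def by blast
  have "p = cls a + cls b" if "cls a = p + cls b"
    using that by (simp add: clsimps)
  moreover have "p = cls a + cls b" if "cls b = p + cls a"
    using that by (simp add: clsimps)
  ultimately have ne': "cls a \<noteq> p + cls b" "p + cls a \<noteq> cls b" "cls b \<noteq> p + cls a"
    using ne by (metis insertCI)+
  have lines: "\<not> covered n T (cls a) \<or> \<not> covered n T (cls b) \<or> \<not> covered n T (cls c)"
    "\<not> covered n T (cls a) \<or> \<not> covered n T (cls b') \<or> \<not> covered n T (cls c')"
    "\<not> covered n T (cls a') \<or> \<not> covered n T (cls b) \<or> \<not> covered n T (cls c')"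
    "\<not> covered n T (cls a') \<or> \<not> covered n T (cls b') \<or> \<not> covered n T (cls c)"
    "\<not> covered n T (cls a) \<or> \<not> covered n T (cls a')"
    "\<not> covered n T (cls b) \<or> \<not> covered n T (cls b')"
    "\<not> covered n T (cls c) \<or> \<not> covered n T (cls c')"
    using plane[of "cls a" "cls b"] plane[of "cls a" "cls b'"] plane[of "cls a'" "cls b"]
      plane[of "cls a'" "cls b'"]
      plane[of "cls a" p] plane[of "cls b" p] plane[of "cls c" p] ne ne' \<open>covered n T p\<close>
    by (auto simp: clsimps)
  define r where "r x = x mod ?N" for x
  have r: "?N dvd x - y \<longleftrightarrow> r x = r y" for x y
    by (simp add: r_def mod_eq_dvd_iff)
  have triple: "\<not> (r x = r u \<and> r y = r v \<and> r z = r w)"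
    if "k + x + y + z = u + v + w" "\<not> ?N dvd k" for k x y z u v w
  proof
    assume "r x = r u \<and> r y = r v \<and> r z = r w"
    then have "?N dvd (x - u) + (y - v) + (z - w)" by (intro dvd_add) (simp_all only: r)
    moreover have "k = - ((x - u) + (y - v) + (z - w))" using that(1) by simp
    ultimately show False using that(2) by (simp only: dvd_minus_iff simp_thms)
  qed
  \<comment> \<open>Each line through \<open>p\<close> has an uncovered class besides
    \<open>p\<close>. Whichever three are chosen, \<open>sa\<close>, \<open>sb\<close>,
    \<open>sc\<close> and at least three of \<open>l0\<close> to \<open>l3\<close> agree modulo
    \<open>?N\<close>, and the identity makes a line sum vanish.\<close>
  have "covered n T (cls a) \<or> r l2 = r l3 \<and> r l2 = r sa"
    "covered n T (cls a') \<or> r l0 = r l1 \<and> r l0 = r sa"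
    "covered n T (cls b) \<or> r l1 = r l3 \<and> r l1 = r sb"
      "covered n T (cls b') \<or> r l0 = r l2 \<and> r l0 = r sb"
    "covered n T (cls c) \<or> r l1 = r l2 \<and> r l1 = r sc"
      "covered n T (cls c') \<or> r l0 = r l3 \<and> r l0 = r sc"
    using unc_a unc_a' unc_b unc_b' unc_c unc_c' by (simp_all only: r) blast+
  moreover have "\<not> (r l1 = r sa \<and> r l2 = r sb \<and> r l3 = r sc)"
    "\<not> (r l0 = r sa \<and> r l2 = r sb \<and> r l3 = r sc)"
    "\<not> (r l1 = r sa \<and> r l0 = r sb \<and> r l3 = r sc)"
      "\<not> (r l1 = r sa \<and> r l2 = r sb \<and> r l0 = r sc)"
    using sum l by (intro triple[of l0] triple[of l1] triple[of l2] triple[of l3]; simp)+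
  ultimately show False using lines by (smt (verit))
qed

section \<open>The complement of a Fano line\<close>

text \<open>This is the complement of a Fano line, in other words an affine plane of the cube
  avoiding 0.\<close>

definition affine :: "elt \<Rightarrow> elt \<Rightarrow> elt \<Rightarrow> elt \<Rightarrow> bool" where
  "affine x y z w \<longleftrightarrow> cls x + cls y + cls z + cls w = 0 \<and> 0 \<notin> {cls x, cls y,
    cls z, cls w} \<and>
     cls x \<noteq> cls y \<and> cls x \<noteq> cls z \<and> cls x \<noteq> cls w \<and> cls y \<noteq>
       cls z \<and> cls y \<noteq> cls w \<and> cls z \<noteq> cls w"

text \<open>A transposition and a 4-cycle, from which all reorderings are obtained.\<close>

lemma affine_perm:
  assumes "affine x y z w"
  shows "affine y x z w" "affine y z w x"
  using assms unfolding affine_def by (auto simp: ac_simps simp del: cube_add_eq_0_iff)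

context
  fixes n :: nat and T D :: "elt multiset"
  assumes n: "n \<ge> 1" and free: "zfree n T" and D: "\<forall>d \<in># D. cls d = 0" and size:
    "size D + 2 \<ge> n"
begin

text \<open>The only missed residue is \<open>- val (sum_mset U)\<close>. As \<open>U\<close> has
  class 0, \<open>W\<close> and its complement share their class, so an unreached element of this
  class makes their values congruent.\<close>

lemma not_covered_affine:
  assumes U: "D + U \<subseteq># T" "U \<noteq> {#}" "cls (sum_mset U) = 0" and W: "W + W' = U"
    "cls (sum_mset W) = v"
    and "\<not> covered n T v"
  shows "2 * int n dvd 2 * val (sum_mset W) - val (sum_mset U)"
proof -
  let ?N = "2 * int n"
  note sub = subset_mset_left[OF U(1)]
  have free': "zfree n D" using zfree_subset[OF free sub[of "{#}"]] by simp
  obtain g where g: "cls g = v" "\<not> reach n T g" using assms(6) by (auto simp: covered_def)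
  have 0: "\<not> hits n D (- val (sum_mset U))" by (rule not_hits_uminus[OF free U(1) D U(2,3)])
  have 1: "?N dvd val g - val (sum_mset V) - - val (sum_mset U)"
    if "V + V' = U" "cls (sum_mset V) = v" for V V'
  proof (rule not_hits_unique[OF n D free' size])
    show "even (val g - val (sum_mset V))" by (rule even_val_diff) (simp add: g that)
    show "even (- val (sum_mset U))" using even_val[OF U(3)] by (simp only: dvd_minus_iff)
    show "\<not> hits n D (val g - val (sum_mset V))"
      using reach_if_hits[OF sub[OF that(1)] D, of g n] g that(2) by auto
  qed (rule 0)
  have s: "val (sum_mset U) = val (sum_mset W) + val (sum_mset W')" by (simp flip: W(1))
  have "cls (sum_mset W) + cls (sum_mset W') = 0" using U(3) by (simp flip: W(1))
  then have "cls (sum_mset W') = v" using W(2) by simp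
  with 1[of W' W] have "?N dvd val g - val (sum_mset W') - - val (sum_mset U)"
    using W(1) by (simp only: add.commute)
  moreover have "?N dvd val g - val (sum_mset W) - - val (sum_mset U)"
    using 1 W by blast
  ultimately show ?thesis
    by (rule dvd_lincomb[where i = 1 and j = "-1"]) (simp add: s)
qed

lemma not_dvd_affine:
  assumes U: "D + U \<subseteq># T" "U \<noteq> {#}" "cls (sum_mset U) = 0"
  shows "\<not> 2 * int n dvd val (sum_mset U)"
  using not_hits_uminus[OF free U(1) D U(2,3)] hits_0[of n "- val (sum_mset U)" D]
  by (metis dvd_minus_iff)

lemma covered_0_affine:
  assumes U: "D + U \<subseteq># T" "U \<noteq> {#}" "cls (sum_mset U) = 0"
  shows "covered n T 0"
  using not_covered_affine[OF U, of "{#}" U 0] not_dvd_affine[OF U] by auto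

text \<open>Each plane has an uncovered class. An uncovered point forces \<open>P\<close>, an
  uncovered sum of two points forces \<open>Q\<close>; once \<open>P\<close> is excluded for all
  points, \<open>Q\<close> remains for all pairs.\<close>

lemma affine_not_good:
  assumes U: "D + {#x, y, z, w#} \<subseteq># T" and aff: "affine x y z w" and bad: "\<not> good n T"
  shows "\<not> 2 * int n dvd 2 * val x - (val x + val y + val z + val w)"
    and "2 * int n dvd 2 * val x + 2 * val y - (val x + val y + val z + val w)"
proof -
  let ?N = "2 * int n" and ?U = "{#x, y, z, w#}"
  define s where "s = val x + val y + val z + val w"
  have cU: "cls (sum_mset ?U) = 0" using aff by (simp add: affine_def add.assoc)
  have vU: "val (sum_mset ?U) = s" by (simp add: s_def)
  have ne: "?U \<noteq> {#}" by simp
  note unc = not_covered_affine[OF U ne cU, unfolded vU]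
  note ns = not_dvd_affine[OF U ne cU, unfolded vU]
  note cov0 = covered_0_affine[OF U ne cU]
  define P where "P u \<longleftrightarrow> ?N dvd 2 * u - s" for u
  define Q where "Q u v \<longleftrightarrow> ?N dvd 2 * (u + v) - s" for u v
  have plane: "P (val u) \<or> P (val v) \<or> Q (val u) (val v)"
    if uv: "{#u, v#} + R = ?U" "cls u \<noteq> 0" "cls v \<noteq> 0" "cls u \<noteq> cls v" for u v R
  proof -
    have "{#u#} + ({#v#} + R) = ?U" "{#v#} + ({#u#} + R) = ?U"
      using uv(1) by (simp_all only: mset_ac)
    from unc[OF this(1)] unc[OF this(2)] unc[OF uv(1)]
    have "\<not> covered n T (cls u) \<longrightarrow> P (val u)"
      "\<not> covered n T (cls v) \<longrightarrow> P (val v)"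
      "\<not> covered n T (cls u + cls v) \<longrightarrow> Q (val u) (val v)"
      by (simp_all add: P_def Q_def)
    moreover have "\<not> covered n T (cls u) \<or> \<not> covered n T (cls v) \<or> \<not> covered n T
      (cls u + cls v)"
      using bad cov0 uv unfolding good_def by blast
    ultimately show ?thesis by blast
  qed
  have planes: "P (val x) \<or> P (val y) \<or> Q (val x) (val y)"
    "P (val x) \<or> P (val z) \<or> Q (val x) (val z)"
    "P (val x) \<or> P (val w) \<or> Q (val x) (val w)" "P (val y) \<or> P (val z) \<or> Q (val y) (val z)"
    "P (val y) \<or> P (val w) \<or> Q (val y) (val w)" "P (val z) \<or> P (val w) \<or> Q (val z) (val w)"
    using plane[of x y "{#z, w#}"] plane[of x z "{#y, w#}"] plane[of x w "{#y, z#}"]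
      plane[of y z "{#x, w#}"] plane[of y w "{#x, z#}"] plane[of z w "{#x, y#}"] aff
    by (simp_all only: mset_ac) (simp_all add: affine_def)
  \<comment> \<open>The plane of differences, spanned by \<open>cls x + cls y\<close> and
    \<open>cls x + cls z\<close>, has an uncovered class as well.\<close>
  have "Q (val x) (val y) \<or> Q (val x) (val z) \<or> Q (val y) (val z)"
  proof -
    have perm: "{#x, y#} + {#z, w#} = ?U" "{#x, z#} + {#y, w#} = ?U" "{#y, z#} + {#x, w#} = ?U"
      by (simp_all only: mset_ac)
    from unc[OF perm(1)] unc[OF perm(2)] unc[OF perm(3)]
    have "\<not> covered n T (cls x + cls y) \<longrightarrow> Q (val x) (val y)"
      "\<not> covered n T (cls x + cls z) \<longrightarrow> Q (val x) (val z)"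
      "\<not> covered n T (cls y + cls z) \<longrightarrow> Q (val y) (val z)"
      by (simp_all add: Q_def)
    moreover have "(cls x + cls y) + (cls x + cls z) = cls y + cls z" by (simp add: ac_simps)
    moreover have "cls x + cls y \<noteq> 0" "cls x + cls z \<noteq> 0" "cls x + cls y \<noteq> cls x + cls z"
      using aff by (simp_all add: affine_def)
    ultimately show ?thesis using bad cov0 unfolding good_def by metis
  qed
  \<comment> \<open>\<open>Q\<close> passes to the complementary pair, so each point belongs to some
    pair satisfying \<open>Q\<close>.\<close>
  moreover have "Q c d" if "Q a b" "a + b + c + d = s" for a b c d
  proof -
    have "2 * (c + d) - s = - (2 * (a + b) - s)" using that(2) by simp
    then show ?thesis using that(1) unfolding Q_def by (simp only: dvd_minus_iff)
  qed
  ultimately have Q: "Q (val x) (val y) \<or> Q (val x) (val z) \<or> Q (val x) (val w)"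
    "Q (val y) (val x) \<or> Q (val y) (val z) \<or> Q (val y) (val w)"
    "Q (val z) (val x) \<or> Q (val z) (val y) \<or> Q (val z) (val w)"
    "Q (val w) (val x) \<or> Q (val w) (val y) \<or> Q (val w) (val z)"
    unfolding s_def by (smt (verit) add.commute)+
  \<comment> \<open>Modulo \<open>?N\<close>, \<open>P a\<close> and \<open>Q a b\<close> give
    \<open>2 * b = 0\<close>. Then \<open>P b\<close> would make \<open>s\<close> vanish, while
    \<open>Q b c\<close> amounts to \<open>P c\<close>. So \<open>P c\<close> and \<open>P d\<close>
    hold, and adding \<open>P a\<close> gives \<open>2 * s = 3 * s\<close>.\<close>
  have contra: "False" if "P a" "Q a b" "P b \<or> P c \<or> Q b c" "P b \<or> P d \<or> Q b d"
    "a + b + c + d = s" for a b c d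
  proof -
    have b: "?N dvd 2 * b"
      using that(1,2) unfolding P_def Q_def by (rule dvd_lincomb[where i = "-1" and j = 1]) simp
    have "\<not> P b" using ns dvd_lincomb[of ?N "2 * b - s" "2 * b" s "-1" 1] b by (auto simp: P_def)
    moreover have "P c" if "Q b c" for c
      using that b unfolding P_def Q_def by (rule dvd_lincomb[where i = 1 and j = "-1"]) simp
    ultimately have "P c" "P d" using that by auto
    with that(1) have "?N dvd (2 * a - s) + (2 * c - s) + (2 * d - s)" unfolding P_def by (intro dvd_add)
    from this b have "?N dvd s"
      by (rule dvd_lincomb[where i = "-1" and j = "-1"]) (use that(5) in simp)
    with ns show False by contradiction
  qed
  have Qsym: "Q a b = Q b a" for a b by (simp add: Q_def add.commute)
  have nP: "\<not> P a" if "Q a b \<or> Q a c \<or> Q a d" "P b \<or> P c \<or> Q b c"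
    "P b \<or> P d \<or> Q b d"
    "P c \<or> P d \<or> Q c d" "a + b + c + d = s" for a b c d
  proof
    assume "P a"
    from contra[OF this, of b c d] contra[OF this, of c b d] contra[OF this, of d b c] that
    show False by (auto simp: Qsym[of c b] Qsym[of d b] Qsym[of d c] ac_simps)
  qed
  have nP: "\<not> P (val x)" "\<not> P (val y)" "\<not> P (val z)" "\<not> P (val w)"
    by (rule nP[OF Q(1)] nP[OF Q(2)] nP[OF Q(3)] nP[OF Q(4)],
        use planes in \<open>simp_all add: Qsym s_def\<close>)+
  show "\<not> ?N dvd 2 * val x - (val x + val y + val z + val w)"
    using nP(1) by (simp add: P_def s_def)
  show "2 * int n dvd 2 * val x + 2 * val y - (val x + val y + val z + val w)"
    using planes(1) nP by (simp add: Q_def s_def distrib_left)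
qed

end

section \<open>Merging a block into its sum, and splitting blocks\<close>

lemma null_0 [simp]: "null n 0"
  by (simp add: null_def)

text \<open>One occurrence of \<open>sum_mset A\<close> in \<open>S\<close> is expanded into
  \<open>A\<close>. Even if \<open>B\<close> contains the same element, deleting that occurrence
  from \<open>S\<close> leaves a part of \<open>B\<close>.\<close>

lemma merge_subset:
  assumes "S \<subseteq># add_mset (sum_mset A) B" "A \<noteq> {#}"
  obtains S' where "S' \<subseteq># A + B" "sum_mset S' = sum_mset S" "S' = {#} \<longleftrightarrow> S = {#}"
proof (cases "sum_mset A \<in># S")
  case True
  then obtain S0 where S: "S = add_mset (sum_mset A) S0" by (metis insert_DiffM)
  then have "S0 \<subseteq># B" using assms(1) by simp
  then show ?thesis using assms(2) by (intro that[of "A + S0"]) (simp_all add: S)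
next
  case False
  have "count S u \<le> count B u" for u
    using assms(1)[unfolded subseteq_mset_def, rule_format, of u] False
    by (cases "u = sum_mset A") (simp_all add: not_in_iff)
  then have "S \<subseteq># B" by (simp add: subseteq_mset_def)
  then show ?thesis
    by (intro that[of S]) (auto intro: subset_mset.order_trans)
qed

lemma zfree_merge:
  assumes "zfree n T" "A + B \<subseteq># T" "A \<noteq> {#}"
  shows "zfree n (add_mset (sum_mset A) B)"
  unfolding zfree_def
proof (intro allI impI)
  fix S assume S: "S \<subseteq># add_mset (sum_mset A) B \<and> null n (sum_mset S)"
  then obtain S' where "S' \<subseteq># A + B" "sum_mset S' = sum_mset S"
    "S' = {#} \<longleftrightarrow> S = {#}"
    using assms(3) merge_subset by blast
  with S assms(1,2) show "S = {#}"
    unfolding zfree_def by (metis subset_mset.order_trans)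
qed

lemma reach_merge:
  assumes "reach n (add_mset (sum_mset A) B) g" "A + B \<subseteq># T" "A \<noteq> {#}"
  shows "reach n T g"
proof -
  obtain S where S: "S \<subseteq># add_mset (sum_mset A) B" "null n (sum_mset S - g)"
    using assms(1) by (auto simp: reach_def)
  obtain S' where "S' \<subseteq># A + B" "sum_mset S' = sum_mset S"
    using merge_subset[OF S(1) assms(3)] by blast
  with S assms(2) show ?thesis
    unfolding reach_def by (metis subset_mset.order_trans)
qed

lemma good_merge:
  assumes "good n (add_mset (sum_mset A) B)" "A + B \<subseteq># T" "A \<noteq> {#}"
  shows "good n T"
proof -
  have "covered n T v" if "covered n (add_mset (sum_mset A) B) v" for v
    using that reach_merge[OF _ assms(2,3)] unfolding covered_def by blast
  with assms(1) show ?thesis unfolding good_def by blast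
qed

text \<open>The negatives of the sums of \<open>B\<close>, \<open>C\<close> and \<open>U\<close> are
  all missed, so two of them agree. Agreement with \<open>U\<close> would make the sum of
  \<open>B'\<close> or \<open>C'\<close> vanish.\<close>

lemma split_blocks:
  assumes "n \<ge> 1" "zfree n T" "D + U \<subseteq># T" "\<forall>d \<in># D. cls d = 0" "size D + 3 \<ge> n"
    and "B + B' = U" "C + C' = U" "B \<noteq> {#}" "B' \<noteq> {#}" "C \<noteq> {#}" "C' \<noteq> {#}"
    and "cls (sum_mset B) = 0" "cls (sum_mset U) = 0" "cls (sum_mset C) = 0"
  shows "2 * int n dvd val (sum_mset B) - val (sum_mset C)"
proof -
  let ?N = "2 * int n"
  note sub = subset_mset_left[OF assms(3)]
  have D: "zfree n D" using zfree_subset[OF assms(2) sub[of "{#}"]] by simp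
  have uB: "sum_mset U = sum_mset B + sum_mset B'" by (simp flip: assms(6))
  have uC: "sum_mset U = sum_mset C + sum_mset C'" by (simp flip: assms(7))
  have nh: "\<not> hits n D (- val (sum_mset X))" if "X + X' = U" "X \<noteq> {#}" "cls (sum_mset X) = 0"
    for X X'
    using not_hits_uminus[OF assms(2) sub[OF that(1)] assms(4) that(2,3)] .
  have ev: "even (- val (sum_mset X))" if "cls (sum_mset X) = 0" for X
    using even_val[OF that] by (simp only: dvd_minus_iff)
  have B': "B' + B = U" and C': "C' + C = U" using assms(6,7) by (simp_all only: add.commute)
  have cl: "cls (sum_mset B') = 0" "cls (sum_mset C') = 0"
    using assms(12-14) arg_cong[OF uB, of cls] arg_cong[OF uC, of cls] by simp_all
  have nd: "\<not> ?N dvd - val (sum_mset X)" if "X + X' = U" "X \<noteq> {#}" "cls (sum_mset X) = 0" for X X'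
    using nh[OF that] hits_0 by blast
  have "?N dvd - val (sum_mset B) - - val (sum_mset C) \<or> ?N dvd - val (sum_mset B) - - val (sum_mset U)
      \<or> ?N dvd - val (sum_mset C) - - val (sum_mset U)"
    by (rule not_hits_three[OF assms(1,4) D assms(5)])
      (use assms nh[of B B'] nh[of C C'] nh[of U "{#}"] ev in auto)
  moreover have "- val (sum_mset B) - - val (sum_mset U) = val (sum_mset B')" by (simp add: uB)
  moreover have "- val (sum_mset C) - - val (sum_mset U) = val (sum_mset C')" by (simp add: uC)
  moreover have "- val (sum_mset B) - - val (sum_mset C) = - (val (sum_mset B) - val (sum_mset C))" by simp
  ultimately show ?thesis
    using nd[OF B' assms(9) cl(1)] nd[OF C' assms(11) cl(2)] by (simp only: dvd_minus_iff) blast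
qed

section \<open>Complements of a Fano line: small \<open>n\<close>, and an extra pair\<close>

lemma affine_sum: "affine x y z w \<Longrightarrow> cls x + cls y + cls z + cls w = 0"
  by (simp only: affine_def)

text \<open>For \<open>n\<close> at most 2 the empty \<open>D\<close> already has enough blocks for
  \<open>affine_not_good\<close>. Three of its relations combine to \<open>4 * val x = s\<close>
  modulo \<open>2 * n\<close>, and \<open>2 * n\<close> divides 4.\<close>

lemma affine_small:
  assumes "n \<ge> 1" "n \<le> 2" "zfree n T" "{#x, y, z, w#} \<subseteq># T" "affine x y z w"
  shows "good n T"
proof (rule ccontr)
  assume bad: "\<not> good n T"
  let ?N = "2 * int n"
  define s where "s = val x + val y + val z + val w"
  have sub: "{#} + {#x, y, z, w#} \<subseteq># T" "{#} + {#x, z, y, w#} \<subseteq># T"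
    "{#} + {#y, z, x, w#} \<subseteq># T"
    using assms(4) by (simp_all only: mset_ac)
  have aff: "affine x z y w" "affine y z x w"
    using affine_perm assms(5) by blast+
  note ang = affine_not_good(2)[OF assms(1,3) _ _ _ _ bad, where D = "{#}"]
  have "?N dvd 2 * val x + 2 * val y - s" "?N dvd 2 * val x + 2 * val z - s" "?N dvd 2 * val y + 2 * val z - s"
    using ang[OF _ _ sub(1) assms(5)] ang[OF _ _ sub(2) aff(1)] ang[OF _ _ sub(3) aff(2)] assms(2)
    by (simp_all add: s_def ac_simps)
  from dvd_lincomb3[OF this, of "4 * val x - s" 1 1 "-1"]
  have "?N dvd 4 * val x - s" by simp
  moreover have "?N dvd 4 * val x" using assms(1,2) 
    by (cases "n = 1") (auto simp: le_Suc_eq numeral_2_eq_2)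
  ultimately have "?N dvd s" by (rule dvd_lincomb[where i = "-1" and j = 1]) simp
  moreover have "\<not> ?N dvd s"
    using not_dvd_affine[OF assms(1,3) _ _ sub(1)] affine_sum[OF assms(5)] assms(2)
    by (simp add: s_def add.assoc)
  ultimately show False by contradiction
qed

text \<open>
  Without the pair the statement fails for odd \<open>n\<close>: one of the merged pairs has to be split again in order to
  have further blocks to compare.
\<close>

lemma good_affine_pair_aux:
  assumes "n \<ge> 1" "zfree n T" "D + {#p, p', x, y, z, w#} \<subseteq># T"
    "\<forall>d \<in># D. cls d = 0" "size D + 3 \<ge> n"
    and aff: "affine x y z w" and p: "cls p' = cls p" and cases: "cls p = cls x \<or> cls p = cls x + cls y"
  shows "good n T"
proof (rule ccontr)
  assume bad: "\<not> good n T"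
  let ?N = "2 * int n" and ?U = "{#p, p', x, y, z, w#}"
  define s where "s = val x + val y + val z + val w"
  \<comment> \<open>In \<open>T1\<close> the pair is merged into one more block, so at least
    \<open>n - 2\<close> blocks are available and the affine analysis applies; in \<open>T\<close>
    it can still be split.\<close>
  define T1 where "T1 = add_mset (sum_mset {#p, p'#}) (D + {#x, y, z, w#})"
  define D1 where "D1 = add_mset (p + p') D"
  note sub = subset_mset_left[OF assms(3)]
  have free: "zfree n D" using zfree_subset[OF assms(2) sub[of "{#}"]] by simp
  have M: "{#p, p'#} + (D + {#x, y, z, w#}) = D + ?U" by (simp add: add_mset_commute)
  have sub1: "{#p, p'#} + (D + {#x, y, z, w#}) \<subseteq># T" unfolding M by (rule assms(3))
  have free1: "zfree n T1" and bad1: "\<not> good n T1"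
    using zfree_merge[OF assms(2) sub1] good_merge[OF _ sub1] bad by (auto simp: T1_def)
  have cov1: "covered n T v" if "covered n T1 v" for v
    unfolding covered_def
  proof (intro allI impI)
    fix g assume "cls g = v"
    with that have "reach n (add_mset (sum_mset {#p, p'#}) (D + {#x, y, z, w#})) g"
      unfolding covered_def T1_def by blast
    then show "reach n T g" by (rule reach_merge[OF _ sub1]) simp
  qed
  have T1: "D1 + {#x, y, z, w#} \<subseteq># T1" by (simp add: T1_def D1_def)
  have D1: "\<forall>d \<in># D1. cls d = 0" "size D1 + 2 \<ge> n" using assms(4,5) p by (auto simp: D1_def)
  have w: "cls w = cls x + cls y + cls z" using affine_sum[OF aff] by simp
  have cU: "cls (sum_mset ?U) = 0" using w p by (simp add: ac_simps)
  \<comment> \<open>Every block inside \<open>?U\<close> with nonempty complement has the same sum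
    as the pair.\<close>
  have spl: "?N dvd val p + val p' - val (sum_mset C)"
    if "C + C' = ?U" "C \<noteq> {#}" "C' \<noteq> {#}" "cls (sum_mset C) = 0" for C C'
    using split_blocks[OF assms(1-5), of "{#p, p'#}" "{#x, y, z, w#}" C C', OF _ that(1) _ _ that(2,3) _
      cU that(4)] p by simp
  have h: "?N dvd val p + val p' - s"
    using spl[of "{#x, y, z, w#}" "{#p, p'#}"] w
      by (simp_all only: mset_ac) (simp_all add: s_def ac_simps)
  have ns: "\<not> ?N dvd s"
    using not_dvd_affine[OF assms(1) free1 D1 T1] w by (simp add: s_def ac_simps)
  from cases show False
  proof
    \<comment> \<open>From the blocks \<open>{#p, x#}\<close> and \<open>{#p', x#}\<close>, both
      \<open>p\<close> and \<open>p'\<close> have the value of \<open>x\<close> modulo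
      \<open>?N\<close>, so \<open>s\<close> becomes \<open>2 * val x\<close>.\<close>
    assume px: "cls p = cls x"
    have "?N dvd val p + val p' - (val p + val x)"
      using spl[of "{#p, x#}" "{#p', y, z, w#}"] px
      by (simp_all only: mset_ac) (simp_all add: ac_simps)
    moreover have "?N dvd val p + val p' - (val p' + val x)"
      using spl[of "{#p', x#}" "{#p, y, z, w#}"] px p
      by (simp_all only: mset_ac) (simp_all add: ac_simps)
    ultimately have "?N dvd 2 * val x - s"
      using h by (rule dvd_lincomb3[where i = "-1" and j = "-1" and k = 1]) simp
    then show False
      using affine_not_good(1)[OF assms(1) free1 D1 T1 aff bad1] by (simp add: s_def)
  next
    \<comment> \<open>The blocks \<open>{#p, x, y#}\<close> and \<open>{#p', x, y#}\<close> make the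
      values of \<open>p\<close> and \<open>p'\<close> congruent, whence
      \<open>2 * val p = s\<close> modulo \<open>?N\<close>.\<close>
    assume px: "cls p = cls x + cls y"
    have "?N dvd val p + val p' - (val p + val x + val y)"
      using spl[of "{#p, x, y#}" "{#p', z, w#}"] px
      by (simp_all only: mset_ac) (simp_all add: ac_simps)
    moreover have "?N dvd val p + val p' - (val p' + val x + val y)"
      using spl[of "{#p', x, y#}" "{#p, z, w#}"] px p
      by (simp_all only: mset_ac) (simp_all add: ac_simps)
    ultimately have p2: "?N dvd 2 * val p - s"
      using h by (rule dvd_lincomb3[where i = "-1" and j = 1 and k = 1]) simp
    have cov: "covered n T (cls u)" if "affine u a b c" "{#u, a, b, c#} = {#x, y, z, w#}" for u a b c
    proof (rule ccontr)
      assume "\<not> covered n T (cls u)"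
      then have ncov: "\<not> covered n T1 (cls u)" using cov1 by blast
      have split: "{#u#} + {#a, b, c#} = {#x, y, z, w#}"
        unfolding that(2)[symmetric] by (simp only: mset_ac)
      have "?N dvd 2 * val (sum_mset {#u#}) - val (sum_mset {#x, y, z, w#})"
        by (rule not_covered_affine[OF assms(1) free1 D1 T1 _ _ split _ ncov]) (simp_all add: w ac_simps)
      moreover have "val (sum_mset {#u, a, b, c#}) = val (sum_mset {#x, y, z, w#})"
        by (simp only: that(2))
      moreover have "\<not> ?N dvd 2 * val u - (val u + val a + val b + val c)"
        by (rule affine_not_good(1)[OF assms(1) free1 D1 T1[folded that(2)] that(1) bad1])
      ultimately show False by (simp add: ac_simps)
    qed
    have affp: "affine x z y w" "affine z x y w" "affine x w y z" using affine_perm aff by blast+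
    have "{#x, z, y, w#} = {#x, y, z, w#}" "{#z, x, y, w#} = {#x, y, z, w#}" "{#x, w, y, z#} = {#x, y, z, w#}"
      by (simp_all only: mset_ac)
    note perm = this
    have "covered n T 0"
      using covered_0_affine[OF assms(1) free1 D1 T1] w cov1 by (simp add: ac_simps)
    moreover have "covered n T (cls x)" "covered n T (cls z)"
      using cov[OF aff] cov[OF affp(2) perm(2)] by simp_all
    \<comment> \<open>The points are covered, so the plane spanned by \<open>cls x\<close> and
      \<open>cls z\<close> can fail only at their sum.\<close>
    ultimately have "\<not> covered n T (cls x + cls z)"
      using bad aff unfolding good_def affine_def by fastforce
    then obtain g where g: "cls g = cls x + cls z" "\<not> reach n T g"
      by (auto simp: covered_def)
    have g1: "?N dvd val g - (val x + val z) + (val p + val p')"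
      using not_reach_block(1)[OF assms(1-5), of "{#x, z#}" "{#p, p'#}" "{#y, w#}" g] g p
      by (simp_all only: mset_ac) (simp_all add: ac_simps)
    \<comment> \<open>The class of \<open>g\<close> is also represented by
      \<open>{#p, x, w#}\<close>, which uses just one half of the pair.\<close>
    have nh1: "\<not> hits n D (val g - (val p + val x + val w))"
    proof
      assume "hits n D (val g - (val p + val x + val w))"
      moreover have "D + {#p, x, w#} \<subseteq># T" by (rule sub[of _ "{#p', y, z#}"]) (simp only: mset_ac)
      moreover have "cls g = cls (sum_mset {#p, x, w#})" using g px w by (simp add: ac_simps)
      ultimately show False using reach_if_hits[of D "{#p, x, w#}" T g n] assms(4) g(2) by (simp add: add.assoc)
    qed
    have nh2: "\<not> hits n D (- (val p + val p'))"
      using not_hits_uminus[OF assms(2) sub[of "{#p, p'#}" "{#x, y, z, w#}"] assms(4)] p by simp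
    have nh3: "\<not> hits n D (- (val p + val p' + s))"
      using not_hits_uminus[OF assms(2) sub[of ?U "{#}"] assms(4) _ cU] by (simp add: s_def ac_simps)
    have "even (val g - (val p + val x + val w))"
      using even_val_diff[of g "p + x + w"] g px w by (simp add: ac_simps)
    moreover have "even (- (val p + val p'))" using even_val[of "p + p'"] p by simp
    moreover have "even (- (val p + val p' + s))"
      using even_val[OF cU] by (simp add: s_def ac_simps)
    ultimately have three: "?N dvd (val g - (val p + val x + val w)) - - (val p + val p')
        \<or> ?N dvd (val g - (val p + val x + val w)) - - (val p + val p' + s)
        \<or> ?N dvd - (val p + val p') - - (val p + val p' + s)"
      by (rule not_hits_three[OF assms(1,4) free assms(5) _ _ _ nh1 nh2 nh3])
    have "?N dvd 2 * val x + 2 * val z - s" "?N dvd 2 * val x + 2 * val w - s"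
      using affine_not_good(2)[OF assms(1) free1 D1 T1[folded perm(1)] affp(1) bad1]
       affine_not_good(2)[OF assms(1) free1 D1 T1[folded perm(3)] affp(3) bad1]
      by (simp_all add: s_def ac_simps)
    from dvd_diff[OF this] have zw: "?N dvd 2 * val z - 2 * val w" by simp
    \<comment> \<open>Doubling either of the first two coincidences and using
      \<open>2 * val z = 2 * val w\<close> and \<open>2 * val p = s\<close> leaves
      \<open>s = 0\<close> modulo \<open>?N\<close>; the third says so directly.\<close>
    from three show False
    proof (elim disjE)
      assume "?N dvd (val g - (val p + val x + val w)) - - (val p + val p')"
      from dvd_lincomb[OF this g1, of "val z - val w - val p" 1 "-1"]
      have "?N dvd val z - val w - val p" by simp
      from dvd_lincomb3[OF this zw p2, of s "-2" 1 "-1"] ns show False by simp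
    next
      assume "?N dvd (val g - (val p + val x + val w)) - - (val p + val p' + s)"
      from dvd_lincomb[OF this g1, of "val z - val w - val p + s" 1 "-1"]
      have "?N dvd val z - val w - val p + s" by simp
      from dvd_lincomb3[OF this zw p2, of s 2 "-1" 1] ns show False by simp
    next
      assume "?N dvd - (val p + val p') - - (val p + val p' + s)"
      with ns show False by simp
    qed
  qed
qed

lemma affine_cases:
  assumes "affine x y z w" "v \<noteq> 0"
  shows "v \<in> {cls x, cls y, cls z, cls w, cls x + cls y, cls x + cls z, cls y + cls z}"
proof -
  have w: "cls w = cls x + cls y + cls z" using affine_sum[OF assms(1)] by simp
  have "cls x \<noteq> 0" "cls y \<noteq> 0" "cls z \<noteq> 0" "cls x \<noteq> cls y"
    "cls x \<noteq> cls z" "cls y \<noteq> cls z"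
    "cls x + cls y \<noteq> cls z"
    using assms(1) w by (auto simp: affine_def)
  from cube_span[OF this, of v] assms(2) w show ?thesis by auto
qed

text \<open>The class of \<open>p\<close> is one of the four points or, on the removed line, a sum
  of two of them; reordering makes it \<open>cls x\<close> or \<open>cls x + cls y\<close>.\<close>

lemma good_affine_pair:
  assumes "n \<ge> 1" "zfree n T" "D + {#p, p', x, y, z, w#} \<subseteq># T"
    "\<forall>d \<in># D. cls d = 0" "size D + 3 \<ge> n"
    and aff: "affine x y z w" and p: "cls p = cls p'" "cls p \<noteq> 0"
  shows "good n T"
proof -
  have aux: "good n T" if "affine a b c d" "{#a, b, c, d#} = {#x, y, z, w#}"
    "cls p = cls a \<or> cls p = cls a + cls b" for a b c d
    using good_affine_pair_aux[OF assms(1,2) _ assms(4,5) that(1) p(1)[symmetric] that(3)] assms(3) by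
      (simp add: that(2))
  have affp: "affine y x z w" "affine z x y w" "affine w x y z" "affine x z y w" "affine y z x w"
    using affine_perm aff by blast+
  have perm: "{#y, x, z, w#} = {#x, y, z, w#}" "{#z, x, y, w#} = {#x, y, z, w#}"
    "{#w, x, y, z#} = {#x, y, z, w#}"
    "{#x, z, y, w#} = {#x, y, z, w#}" "{#y, z, x, w#} = {#x, y, z, w#}"
    by (simp_all only: mset_ac)
  from affine_cases[OF aff p(2)] aux[OF aff] aux[OF affp(1) perm(1)] aux[OF affp(2) perm(2)]
    aux[OF affp(3) perm(3)] aux[OF affp(4) perm(4)] aux[OF affp(5) perm(5)]
  show ?thesis by blast
qed

section \<open>Pairing off equal classes\<close>

abbreviation pairs :: "(elt \<times> elt) multiset \<Rightarrow> elt multiset" where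
  "pairs P \<equiv> \<Sum>\<^sub># {#{#p, q#}. (p, q) \<in># P#}"

abbreviation pair_sums :: "(elt \<times> elt) multiset \<Rightarrow> elt multiset" where
  "pair_sums P \<equiv> {#p + q. (p, q) \<in># P#}"

text \<open>A new element joins \<open>D\<close>, opens a new class in \<open>xs\<close>, or is
  matched with the entry of \<open>xs\<close> of its class. Both members of a pair are recorded
  because a pair may have to be split later.\<close>

lemma decompose:
  obtains D P xs where "T = D + pairs P + mset xs" "\<forall>d \<in># D. cls d = 0"
    "\<forall>(p, q) \<in># P. cls p = cls q \<and> cls p \<noteq> 0" "distinct (map cls xs)"
      "0 \<notin> cls ` set xs"
proof (induction T arbitrary: thesis)
  case empty
  show ?case by (rule empty[of "{#}" "{#}" "[]"]) simp_all
next
  case (add x T)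
  obtain D P xs where IH: "T = D + pairs P + mset xs" "\<forall>d \<in># D. cls d = 0"
    "\<forall>(p, q) \<in># P. cls p = cls q \<and> cls p \<noteq> 0" "distinct (map cls xs)"
      "0 \<notin> cls ` set xs"
    by (rule add.IH)
  consider "cls x = 0" | "cls x \<noteq> 0" "cls x \<notin> cls ` set xs" | "cls x \<noteq> 0"
    "cls x \<in> cls ` set xs" by blast
  then show ?case
  proof cases
    case 1
    then show ?thesis by (intro add.prems[of "add_mset x D" P xs]) (use IH in simp_all)
  next
    case 2
    then show ?thesis by (intro add.prems[of D P "x # xs"]) (use IH in auto)
  next
    case 3
    then obtain y where y: "y \<in> set xs" "cls y = cls x" by auto
    obtain us vs where xs: "xs = us @ y # vs" using split_list[OF y(1)] by blast
    show ?thesis by (rule add.prems[of D "add_mset (x, y) P" "us @ vs"]) (use IH xs y 3 in auto)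
  qed
qed

lemma size_pairs: "size (pairs P) = 2 * size P"
  by (induction P) auto

lemma zfree_pair_sums: "zfree n (pairs P + B) \<Longrightarrow> zfree n (pair_sums P + B)"
proof (induction P arbitrary: B)
  case (add x P)
  obtain p q where x: "x = (p, q)" by (cases x)
  have "pairs (add_mset x P) + B = {#p, q#} + (pairs P + B)" by (simp add: x)
  with add.prems have "zfree n (add_mset (sum_mset {#p, q#}) (pairs P + B))"
    using zfree_merge[of n _ "{#p, q#}" "pairs P + B"] by simp
  then have "zfree n (pairs P + add_mset (p + q) B)" by simp
  from add.IH[OF this] show ?case by (simp add: x)
qed simp

lemma good_pair_sums: "good n (pair_sums P + B) \<Longrightarrow> good n (pairs P + B)"
proof (induction P arbitrary: B)
  case (add x P)
  obtain p q where x: "x = (p, q)" by (cases x)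
  have "pairs (add_mset x P) + B = {#p, q#} + (pairs P + B)" by (simp add: x)
  moreover have "good n (pairs P + add_mset (p + q) B)"
    by (rule add.IH) (use add.prems in \<open>simp add: x\<close>)
  ultimately show ?case using good_merge[of n "{#p, q#}" "pairs P + B"] by simp
qed simp

lemma pick_classes:
  assumes "distinct vs" "set vs \<subseteq> cls ` set xs"
    "\<And>v. v \<in> cls ` set xs \<Longrightarrow> f v \<in> set xs \<and> cls (f v) = v"
  shows "mset (map f vs) \<subseteq># mset xs"
proof -
  have "inj_on f (set vs)"
    using assms(2,3) by (intro inj_on_inverseI[of _ cls]) blast
  then have "distinct (map f vs)" using assms(1) by (simp add: distinct_map)
  moreover have "set (map f vs) \<subseteq> set xs" unfolding set_map using assms(2,3) by blast
  ultimately have "mset (map f vs) = mset_set (set (map f vs))" by (metis mset_set_set)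
  moreover have "mset_set (set (map f vs)) \<subseteq># mset_set (set xs)"
    using \<open>set (map f vs) \<subseteq> set xs\<close> by (rule subset_imp_msubset_mset_set) simp
  moreover have "mset_set (set xs) \<subseteq># mset xs"
    by (metis mset_remdups_subset_eq mset_set_set distinct_remdups set_remdups)
  ultimately show ?thesis by (metis subset_mset.order_trans)
qed

text \<open>Four distinct nonzero classes contain a line or form an affine plane, and a fifth class
  lies on a line through two points of the affine plane. A line with a further point is settled by
  \<open>good_line_point\<close>.\<close>

lemma good_four_classes:
  assumes n: "n \<ge> 1" "zfree n (E + mset xs)" "\<forall>d \<in># E. cls d = 0" "size E + 2 \<ge> n"
    and xs: "distinct (map cls xs)" "0 \<notin> cls ` set xs" "length xs \<ge> 4"
  shows "good n (E + mset xs) \<or> (\<exists>x y z w. xs = [x, y, z, w] \<and> affine x y z w)"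
proof -
  obtain x y z w ys where X: "xs = x # y # z # w # ys"
    using xs(3) by (auto simp: numeral_eq_Suc Suc_le_length_iff)
  have line: "good n (E + mset xs)"
    if M: "mset xs = {#q, a, b, c#} + M" and c: "cls c = cls a + cls b" for a b c q M
  proof -
    obtain zs where zs: "M = mset zs" by (metis ex_mset)
    have eq: "mset xs = mset ([q, a, b, c] @ zs)" using M zs by simp
    have "distinct (map cls ([q, a, b, c] @ zs))"
      using xs(1) eq by (metis mset_eq_imp_distinct_iff mset_map)
    then have d: "distinct (map cls [q, a, b, c])" by simp
    have "set xs = set ([q, a, b, c] @ zs)" using eq by (rule mset_eq_setD)
    then have "0 \<notin> cls ` set [q, a, b, c]" using xs(2) by simp
    with d show ?thesis
      by (intro good_line_point[OF n(1,2) _ n(3,4), of q a b c]) (simp_all add: M c[symmetric])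
  qed
  have d: "distinct (map cls (x # y # z # w # ys))" "0 \<notin> cls ` set (x # y # z # w # ys)"
    using xs X by simp_all
  show ?thesis
  proof (cases "cls w = cls x + cls y + cls z")
    case True
    then have A: "affine x y z w" using d by (auto simp: affine_def)
    show ?thesis
    proof (cases ys)
      case Nil
      with X A show ?thesis by blast
    next
      case (Cons u us)
      have "cls u = cls x + cls y \<or> cls u = cls x + cls z \<or> cls u = cls y + cls z"
        using affine_cases[OF A, of "cls u"] d Cons by auto
      then show ?thesis
        using line[of z x y u "mset (w # us)"] line[of y x z u "mset (w # us)"] line[of x y z u "mset (w # us)"]
        unfolding X Cons by (simp only: mset.simps mset_ac) blast
    qed
  next
    case False
    have "cls z = cls x + cls y \<or> cls w = cls x + cls y \<or> cls w = cls x + cls z \<or> cls w = cls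
      y + cls z"
      using cube_span[of "cls x" "cls y" "cls z" "cls w"] d False by auto
    then show ?thesis
      using line[of w x y z "mset ys"] line[of z x y w "mset ys"] line[of y x z w "mset ys"]
        line[of x y z w "mset ys"]
      unfolding X by (simp only: mset.simps mset_ac) blast
  qed
qed

theorem good_if_size:
  assumes n: "n \<ge> 1" and free: "zfree n T" and size: "size T \<ge> 2 * n"
  shows "good n T"
proof -
  obtain D P xs where T: "T = D + pairs P + mset xs" and D: "\<forall>d \<in># D. cls d = 0"
    and P: "\<forall>(p, q) \<in># P. cls p = cls q \<and> cls p \<noteq> 0" and xs:
      "distinct (map cls xs)" "0 \<notin> cls ` set xs"
    by (rule decompose)
  define E where "E = D + pair_sums P"
  have T': "T = pairs P + (D + mset xs)" by (simp add: T ac_simps)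
  have E': "E + mset xs = pair_sums P + (D + mset xs)" by (simp add: E_def ac_simps)
  have freeE: "zfree n (E + mset xs)" using free unfolding T' E' by (rule zfree_pair_sums)
  have goodE: "good n T" if "good n (E + mset xs)" using that unfolding T' E' by (rule good_pair_sums)
  have pair_sums: "cls d = 0" if "d \<in># pair_sums P'" "P' \<subseteq># P" for d P'
  proof -
    have "\<exists>pq\<in>#P'. d = (case pq of (p, q) \<Rightarrow> p + q)"
      using that(1) by (simp only: set_image_mset image_iff)
    then obtain p q where pq: "(p, q) \<in># P'" "d = p + q" by (metis case_prod_conv surj_pair)
    have "(p, q) \<in># P" using pq(1) by (rule mset_subset_eqD[OF that(2)])
    from bspec[OF P this] show ?thesis by (simp add: pq(2))
  qed
  have E: "\<forall>d \<in># E. cls d = 0" using D pair_sums[of _ P] unfolding E_def by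
    (metis subset_mset.order_refl union_iff)
  have sizes: "2 * size E + length xs = size T + size D"
    unfolding T E_def size_union size_pairs size_image_mset size_mset by simp
  have len: "card (cls ` set xs) = length xs"
    using xs(1) by (metis distinct_card length_map set_map)
  \<comment> \<open>As \<open>2 * size E + length xs\<close> is at least \<open>2 * n\<close>, the
    four ranges give \<open>size E\<close> at least \<open>n\<close> (impossible),
    \<open>n - 1\<close>, \<open>n - 2\<close> and, there being only seven nonzero classes,
    \<open>n - 3\<close>.\<close>
  consider "length xs \<le> 1" | "2 \<le> length xs" "length xs \<le> 3" | "4 \<le> length xs"
    "length xs \<le> 5" | "6 \<le> length xs"
    by linarith
  then show ?thesis
  proof cases
    case 1
    then have "size E \<ge> n" using sizes size by linarith
    moreover have "size E < n"
      by (rule size_zfree_less[OF n E zfree_subset[OF freeE]]) simp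
    ultimately show ?thesis by simp
  next
    case 2
    then obtain x y zs where X: "xs = x # y # zs"
      by (cases xs rule: list.exhaust) (auto simp: numeral_eq_Suc Suc_le_length_iff)
    have "size E + 1 \<ge> n" using sizes size 2 by linarith
    then have "good n (E + mset xs)"
      using xs by (intro good_if_full[OF n freeE _ E, of x y]) (auto simp: X)
    then show ?thesis by (rule goodE)
  next
    case 3
    have E2: "size E + 2 \<ge> n" using sizes size 3 by linarith
    have "good n T" if X: "xs = [x, y, z, w]" and A: "affine x y z w" for x y z w
    proof (cases "n \<le> 2")
      case True
      have "{#x, y, z, w#} \<subseteq># E + mset xs" by (simp add: X)
      then show ?thesis using goodE affine_small[OF n True freeE _ A] by blast
    next
      case False
      show ?thesis
      proof (cases P)
        case empty
        \<comment> \<open>Without pairs \<open>E\<close> is \<open>D\<close>, so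
          \<open>sizes\<close> bounds \<open>size E\<close> below by \<open>2 * n - 4\<close>, which
          is at least \<open>n - 1\<close> because \<open>n\<close> exceeds 2.\<close>
        then have "size E + 1 \<ge> n" using sizes size False X by (simp add: E_def)
        then have "good n (E + mset xs)"
          using xs by (intro good_if_full[OF n freeE _ E, of x y]) (simp_all add: X)
        then show ?thesis by (rule goodE)
      next
        case (add pq P')
        obtain p q where pq: "pq = (p, q)" by (cases pq)
        \<comment> \<open>One pair is left unmerged, at the price of one block.\<close>
        let ?F = "D + pair_sums P'"
        have T': "T = pairs P' + (D + {#p, q#} + mset xs)" by (simp add: T add pq ac_simps)
        have "pair_sums P' + (D + {#p, q#} + mset xs) = ?F + {#p, q, x, y, z, w#}"
          by (simp add: X ac_simps)
        then have F: "zfree n (?F + {#p, q, x, y, z, w#})"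
          "good n (?F + {#p, q, x, y, z, w#}) \<Longrightarrow> good n T"
          using free unfolding T' by (metis zfree_pair_sums, metis good_pair_sums)
        have "\<forall>d \<in># ?F. cls d = 0"
        proof
          fix d assume "d \<in># ?F"
          then show "cls d = 0"
          proof (unfold union_iff, elim disjE)
            assume "d \<in># pair_sums P'"
            moreover have "P' \<subseteq># P" by (simp add: add)
            ultimately show ?thesis by (rule pair_sums)
          qed (use D in blast)
        qed
        moreover have "size ?F + 3 \<ge> n" using E2 by (simp add: E_def add)
        moreover have "cls p = cls q \<and> cls p \<noteq> 0"
        proof -
          have "(p, q) \<in># P" by (simp add: add pq)
          from bspec[OF P this] show ?thesis unfolding prod.case .
        qed
        ultimately show ?thesis using F(2) good_affine_pair[OF n F(1) subset_mset.order_refl _ _ A] by blast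
      qed
    qed
    then show ?thesis
      using good_four_classes[OF n freeE E E2 xs 3(1)] goodE by blast
  next
    case 4
    have fin: "finite (UNIV :: (bit \<times> bit \<times> bit) set)" by (rule cube_UNIV)
    have "card (cls ` set xs) \<le> card (UNIV - {0 :: bit \<times> bit \<times> bit})"
      using xs(2) by (intro card_mono finite_subset[OF subset_UNIV fin]) blast
    also have "\<dots> = 7" using cube_UNIV by (subst card_Diff_subset) simp_all
    finally have "length xs \<le> 7" using len by simp
    then have E3: "size E + 3 \<ge> n" using sizes size by linarith
    have "card (cls ` set xs) \<ge> 6" using 4 len by simp
    then obtain a b p where abp: "a \<noteq> 0" "b \<noteq> 0" "a \<noteq> b" "p \<notin> {0, a, b, a + b}"
      and sub: "{a, a + p, b, b + p, a + b, a + b + p} \<subseteq> cls ` set xs"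
      using six_classes[OF xs(2)] by metis
    define f where "f = inv_into (set xs) cls"
    have f: "f v \<in> set xs \<and> cls (f v) = v" if "v \<in> cls ` set xs" for v
      unfolding f_def using that by (simp add: inv_into_into f_inv_into_f)
    let ?vs = "[a, a + p, b, b + p, a + b, a + b + p]"
    have "distinct ?vs"
    proof -
      have "a + p \<noteq> b" "b + p \<noteq> a"
        using abp(4) by (metis add.commute cube_add_self_left insertCI)+
      moreover from this[symmetric] have "b \<noteq> a + p" "a \<noteq> b + p" by blast+
      moreover have "a \<noteq> p" "b \<noteq> p" using abp(4) by blast+
      ultimately show ?thesis
        using abp by (simp add: add.assoc cube_eq_iffs)
    qed
    then have "mset (map f ?vs) \<subseteq># mset xs"
      using sub by (intro pick_classes f) simp_all
    then have M: "E + {#f a, f (a + p), f b, f (b + p), f (a + b), f (a + b + p)#} \<subseteq># E + mset xs"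
      by (intro subset_mset.add_left_mono) simp
    have "set ?vs \<subseteq> cls ` set xs" using sub by simp
    then have c: "\<forall>v \<in> set ?vs. cls (f v) = v" using f by blast
    have "good n (E + mset xs)"
      by (rule good_six[OF n freeE M E E3, where p = p]) (use c abp in simp_all)
    then show ?thesis by (rule goodE)
  qed
qed

section \<open>Transfer to the group\<close>

lemma null_add: "null n x \<Longrightarrow> null n y \<Longrightarrow> null n (x + y)"
  by (simp add: null_def)

lemma null_diff: "null n x \<Longrightarrow> null n y \<Longrightarrow> null n (x - y)"
  by (simp add: null_def)

lemma null_cong: "null n (x - y) \<Longrightarrow> null n x \<longleftrightarrow> null n y"
  using null_add[of n "x - y" y] null_diff[of n x "x - y"] by auto

lemma size_zfree_le:
  assumes "n \<ge> 1" "zfree n T"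
  shows "size T \<le> 2 * n + 1"
proof (rule ccontr)
  assume big: "\<not> size T \<le> 2 * n + 1"
  define k where "k = size T - 2"
  have "size T = Suc (Suc k)" "k \<ge> 2 * n" using big by (simp_all add: k_def)
  obtain x T' where T': "T = add_mset x T'"
    using size_eq_Suc_imp_eq_union[OF \<open>size T = Suc (Suc k)\<close>] by blast
  then have "size T' = Suc k" using \<open>size T = Suc (Suc k)\<close> by simp
  then obtain y U where U: "T' = add_mset y U"
    using size_eq_Suc_imp_eq_union by blast
  then have "size U \<ge> 2 * n" using \<open>size T' = Suc k\<close> \<open>k \<ge> 2 * n\<close> by simp
  have T: "T = U + {#x, y#}" by (simp add: T' U)
  have "good n U"
    using \<open>size U \<ge> 2 * n\<close> by (intro good_if_size[OF assms(1) zfree_subset[OF assms(2)]])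
      (simp_all add: T)
  then obtain v w where vw: "v \<noteq> 0" "w \<noteq> 0" "v \<noteq> w" and cov:
    "\<forall>u \<in> {0, v, w, v + w}. covered n U u"
    unfolding good_def by blast
  \<comment> \<open>If \<open>sum_mset W\<close> lay in a covered class, some subsum of
    \<open>U\<close> would be its negative, against \<open>zfree n T\<close>.\<close>
  have contra: "cls (sum_mset W) \<notin> {0, v, w, v + w}" if W: "W \<subseteq># {#x, y#}"
    "W \<noteq> {#}" for W
  proof
    assume "cls (sum_mset W) \<in> {0, v, w, v + w}"
    with cov have "covered n U (cls (sum_mset W))" by blast
    moreover have "cls (0 - sum_mset W) = cls (sum_mset W)" by (simp only: cls_simps add_0)
    ultimately have "reach n U (0 - sum_mset W)" unfolding covered_def by blast
    then obtain S where S: "S \<subseteq># U" "null n (sum_mset S - (0 - sum_mset W))"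
      unfolding reach_def by blast
    then have null: "null n (sum_mset (S + W))" by simp
    have "S + W \<subseteq># T" unfolding T using S(1) W(1) by (rule subset_mset.add_mono)
    with null assms(2) W(2) show False unfolding zfree_def by (metis union_eq_empty)
  qed
  have "cls x \<notin> {0, v, w, v + w}" "cls y \<notin> {0, v, w, v + w}"
    "cls x + cls y \<notin> {0, v, w, v + w}"
    using contra[of "{#x#}"] contra[of "{#y#}"] contra[of "{#x, y#}"] by simp_all
  with plane_add[OF vw] show False by blast
qed

lemma sum_mset_replicate_triple:
  "sum_mset (replicate_mset k (a, b, c)) = (of_nat k * a, of_nat k * b, of_nat k * (c :: int))"
  by (induction k) (simp_all add: zero_prod_def algebra_simps)

text \<open>The extremal sequence: a subsequence is given by three multiplicities, each smaller than
  the order of the repeated element.\<close>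

lemma zfree_example:
  assumes "n \<ge> 1"
  shows "zfree n (replicate_mset (2 * n - 1) (0, 0, 1) + {#(1, 0, 0), (0, 1, 0)#})"
  unfolding zfree_def
proof (intro allI impI, elim conjE)
  fix S :: "elt multiset"
  let ?t = "(0, 0, 1) :: elt" and ?a = "(1, 0, 0) :: elt" and ?b = "(0, 1, 0) :: elt"
  assume S: "S \<subseteq># replicate_mset (2 * n - 1) ?t + {#?a, ?b#}" and null: "null n (sum_mset S)"
  have count: "count S x \<le> count (replicate_mset (2 * n - 1) ?t + {#?a, ?b#}) x" for x
    using S by (rule mset_subset_eq_count)
  have "S = replicate_mset (count S ?t) ?t + replicate_mset (count S ?a) ?a + replicate_mset (count S ?b) ?b"
    (is "S = ?S")
  proof (rule multiset_eqI)
    fix x show "count S x = count ?S x" using count[of x] by (auto split: if_splits)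
  qed
  then have "sum_mset S = sum_mset ?S" by simp
  also have "\<dots> = (of_nat (count S ?a), of_nat (count S ?b), int (count S ?t))"
    by (simp only: sum_mset.union sum_mset_replicate_triple) simp
  finally have sum: "sum_mset S = (of_nat (count S ?a), of_nat (count S ?b), int (count S ?t))" .
  have "count S ?a \<le> 1" "count S ?b \<le> 1" "count S ?t < 2 * n"
    using count[of ?a] count[of ?b] count[of ?t] assms by auto
  moreover from null sum have "of_nat (count S ?a) = (0 :: bit)" "of_nat (count S ?b) = (0 :: bit)"
    "2 * int n dvd int (count S ?t)"
    by (simp_all add: null_def cls_def val_def zero_prod_def)
  ultimately have "count S ?a = 0" "count S ?b = 0" "count S ?t = 0"
    by (auto simp: le_Suc_eq dest: zdvd_imp_le)
  with \<open>S = ?S\<close> show "S = {#}" by (metis replicate_mset_0 add_0)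
qed

text \<open>An isomorphism onto the sum of cyclic groups, read through representatives: these are
  not closed under integer addition, so \<open>L\<close> is additive only up to
  \<open>null n\<close>.\<close>

locale lift = comm_group G for G :: "('a, 'b) monoid_scheme" (structure) +
  fixes n :: nat and L :: "'a \<Rightarrow> elt"
  assumes n: "n \<ge> 1"
    and L_mult: "x \<in> carrier G \<Longrightarrow> y \<in> carrier G \<Longrightarrow> null n (L (x
      \<otimes> y) - (L x + L y))"
    and L_inj: "x \<in> carrier G \<Longrightarrow> y \<in> carrier G \<Longrightarrow> null n (L x - L y)
      \<Longrightarrow> x = y"
    and L_surj: "0 \<le> c \<Longrightarrow> c < 2 * int n \<Longrightarrow> \<exists>x \<in> carrier G. L
      x = (a, b, c)"
begin

lemma seq_sum_closed: "seq_over G S \<Longrightarrow> seq_sum G S \<in> carrier G"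
  unfolding seq_sum_def seq_over_def by (intro finprod_closed) auto

lemma seq_sum_add_mset:
  assumes "seq_over G (add_mset x S)"
  shows "seq_sum G (add_mset x S) = x \<otimes> seq_sum G S"
proof -
  have x: "x \<in> carrier G" and S: "set_mset S \<subseteq> carrier G" using assms by (auto simp: seq_over_def)
  let ?A = "set_mset S - {x}"
  let ?f = "\<lambda>g. g [^] count S g"
  have f: "?f \<in> ?A \<rightarrow> carrier G" "?f x \<in> carrier G" using S x by auto
  have "seq_sum G (add_mset x S) = finprod G (\<lambda>g. g [^] count (add_mset x S) g) (insert x ?A)"
    by (simp add: seq_sum_def)
  also have "\<dots> = x [^] Suc (count S x) \<otimes> finprod G (\<lambda>g. g [^] count (add_mset x S) g) ?A"
    using S x by (subst finprod_insert) auto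
  also have "finprod G (\<lambda>g. g [^] count (add_mset x S) g) ?A = finprod G ?f ?A"
    using f by (intro finprod_cong') auto
  also have "x [^] Suc (count S x) \<otimes> finprod G ?f ?A = x \<otimes> (?f x \<otimes> finprod G ?f ?A)"
    using x f by (simp add: m_ac finprod_closed)
  also have "?f x \<otimes> finprod G ?f ?A = finprod G ?f (insert x ?A)"
    using f by (subst finprod_insert) auto
  also have "finprod G ?f (insert x ?A) = seq_sum G S"
  proof (cases "x \<in># S")
    case True
    then show ?thesis by (simp add: seq_sum_def insert_absorb)
  next
    case False
    then have "insert x ?A = insert x (set_mset S)" "count S x = 0" by (auto simp: not_in_iff)
    then show ?thesis using False S x unfolding seq_sum_def by (subst finprod_insert)
      (auto intro!: l_one finprod_closed)
  qed
  finally show ?thesis .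
qed

lemma L_one: "null n (L \<one>)"
  using L_mult[of \<one> \<one>] null_diff[of n 0 "L \<one> - (L \<one> + L \<one>)"] by simp

lemma L_eq_one_iff: "x \<in> carrier G \<Longrightarrow> null n (L x) \<longleftrightarrow> x = \<one>"
  using L_inj[of x \<one>] L_one null_diff[of n "L x" "L \<one>"] by auto

lemma L_seq_sum: "seq_over G S \<Longrightarrow> null n (L (seq_sum G S) - sum_mset (image_mset L S))"
proof (induction S)
  case empty
  then show ?case using L_one by (simp add: seq_sum_def)
next
  case (add x S)
  then have x: "x \<in> carrier G" and S: "seq_over G S" by (auto simp: seq_over_def)
  have "null n ((L (x \<otimes> seq_sum G S) - (L x + L (seq_sum G S))) + (L (seq_sum G S) - sum_mset
    (image_mset L S)))"
    using x S by (intro null_add L_mult add.IH seq_sum_closed)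
  then show ?case using add.prems by (simp add: seq_sum_add_mset algebra_simps)
qed

text \<open>Subsequences of the lifted sequence are precisely the lifts of subsequences, and
  \<open>null n\<close> recognises the neutral element.\<close>

lemma zero_sum_free_iff: "zero_sum_free G T \<longleftrightarrow> seq_over G T \<and> zfree n (image_mset L T)"
proof -
  have "\<one> \<notin> subseq_sums G T \<longleftrightarrow> zfree n (image_mset L T)" if T: "seq_over G T"
  proof -
    have *: "seq_sum G S = \<one> \<longleftrightarrow> null n (sum_mset (image_mset L S))" if
      "S \<subseteq># T" for S
    proof -
      have S: "seq_over G S" using T set_mset_mono[OF that] by (auto simp: seq_over_def)
      have "seq_sum G S = \<one> \<longleftrightarrow> null n (L (seq_sum G S))"
        using L_eq_one_iff seq_sum_closed[OF S] by simp
      also have "\<dots> \<longleftrightarrow> null n (sum_mset (image_mset L S))"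
        by (rule null_cong[OF L_seq_sum[OF S]])
      finally show ?thesis .
    qed
    have "zfree n (image_mset L T) \<longleftrightarrow> (\<forall>S. S \<subseteq># T \<and> null n
      (sum_mset (image_mset L S)) \<longrightarrow> S = {#})"
    proof
      assume "zfree n (image_mset L T)"
      then show "\<forall>S. S \<subseteq># T \<and> null n (sum_mset (image_mset L S)) \<longrightarrow>
        S = {#}"
        unfolding zfree_def by (metis image_mset_subseteq_mono image_mset_is_empty_iff)
    next
      assume R: "\<forall>S. S \<subseteq># T \<and> null n (sum_mset (image_mset L S)) \<longrightarrow>
        S = {#}"
      show "zfree n (image_mset L T)"
        unfolding zfree_def
      proof (intro allI impI, elim conjE)
        fix S' assume S': "S' \<subseteq># image_mset L T" "null n (sum_mset S')"
        then obtain C where "image_mset L T = S' + C" by (metis subset_mset.le_iff_add)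
        then obtain S C' where "T = S + C'" "S' = image_mset L S" by (metis image_mset_eq_plusD)
        with R S' show "S' = {#}" by simp
      qed
    qed
    also have "\<dots> \<longleftrightarrow> \<one> \<notin> subseq_sums G T"
      unfolding subseq_sums_def using * by fastforce
    finally show ?thesis by simp
  qed
  then show ?thesis unfolding zero_sum_free_def by blast
qed

lemma subseq_sumsI:
  assumes T: "seq_over G T" and x: "x \<in> nonzero_elems G" and "reach n (image_mset L T) (L x)"
  shows "x \<in> subseq_sums G T"
proof -
  obtain S' where S': "S' \<subseteq># image_mset L T" "null n (sum_mset S' - L x)"
    using assms(3) unfolding reach_def by blast
  then obtain C where "image_mset L T = S' + C" by (metis subset_mset.le_iff_add)
  then obtain S C' where S: "T = S + C'" "S' = image_mset L S" by (metis image_mset_eq_plusD)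
  have So: "seq_over G S" using T by (simp add: seq_over_def S(1))
  have "null n ((L (seq_sum G S) - sum_mset S') + (sum_mset S' - L x))"
    using L_seq_sum[OF So] S'(2) by (intro null_add) (simp_all add: S(2))
  then have "seq_sum G S = x"
    using x So by (intro L_inj seq_sum_closed) (simp_all add: nonzero_elems_def)
  \<comment> \<open>\<open>reach\<close> admits the empty subsequence; it is excluded here because
    \<open>x\<close> is not neutral.\<close>
  moreover from this have "S \<noteq> {#}" using x by (auto simp: seq_sum_def nonzero_elems_def)
  ultimately show ?thesis unfolding subseq_sums_def using S(1) by auto
qed

definition C :: "'a \<Rightarrow> bit \<times> bit \<times> bit" where
  "C x = cls (L x)"

lemma C_mult [simp]: "x \<in> carrier G \<Longrightarrow> y \<in> carrier G \<Longrightarrow> C (x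
  \<otimes> y) = C x + C y"
  using L_mult[of x y] by (simp add: null_def C_def)

lemma C_one [simp]: "C \<one> = 0"
  using L_one by (simp add: null_def C_def)

lemma C_inv [simp]: "x \<in> carrier G \<Longrightarrow> C (inv x) = C x"
  using C_mult[of x "inv x"] by (simp del: C_mult)

lemma C_surj: "\<exists>x \<in> carrier G. C x = v"
proof -
  obtain a b c where v: "v = (a, b, c)" by (cases v)
  define k :: int where "k = (if c = 0 then 0 else 1)"
  have k: "0 \<le> k" "k < 2 * int n" "of_int k = c" using n by (cases c; simp add: k_def)+
  then obtain x where "x \<in> carrier G" "L x = (a, b, k)" using L_surj by blast
  then show ?thesis using k(3) by (intro bexI[of _ x]) (simp_all add: C_def cls_def val_def v)
qed

text \<open>\<open>H\<close> is the preimage of the covered plane, so all its elements other than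
  the neutral one are subsums. Having index 2, it leaves a single coset for the missed
  elements.\<close>

lemma covering_subgroup:
  assumes T: "zero_sum_free G T" "size T \<ge> 2 * n"
  shows "\<exists>H \<alpha>. subgroup H G \<and> card (rcosets H) = 2 \<and> \<alpha> \<in> carrier G - H
    \<and>
    nonzero_elems G - subseq_sums G T \<subseteq> \<alpha> <# H"
proof -
  have over: "seq_over G T" and "zfree n (image_mset L T)" using T(1) zero_sum_free_iff by blast+
  then have "good n (image_mset L T)" using T(2) n by (intro good_if_size) simp_all
  then obtain v w where vw: "v \<noteq> 0" "w \<noteq> 0" "v \<noteq> w"
    and cov: "\<forall>u \<in> {0, v, w, v + w}. covered n (image_mset L T) u"
    unfolding good_def by blast
  define P where "P = {0, v, w, v + w}"
  define H where "H = {x \<in> carrier G. C x \<in> P}"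
  have P: "a + b \<in> P" if "a \<in> P" "b \<in> P" for a b
    using that unfolding P_def by (elim insertE emptyE; simp add: ac_simps)
  have nP: "a + b \<in> P" if "a \<notin> P" "b \<notin> P" for a b
    using plane_add[OF vw] that unfolding P_def by blast
  have "0 \<in> P" by (simp add: P_def)
  have nPP: "a + b \<notin> P" if "a \<in> P" "b \<notin> P" for a b
    using P[OF that(1), of "a + b"] that(2) by auto
  have H: "subgroup H G"
    by (rule subgroupI) (use P \<open>0 \<in> P\<close> in \<open>auto simp: H_def intro!: exI[of _
      \<one>]\<close>)
  have "card P \<le> 4" using card_length[of "[0, v, w, v + w]"] by (simp add: P_def)
  then have "P \<noteq> UNIV" using cube_UNIV(2) by auto
  then obtain u where "u \<notin> P" by blast
  then obtain \<alpha> where \<alpha>: "\<alpha> \<in> carrier G - H" using C_surj[of u] by (auto simp: H_def)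
  have left: "\<alpha> <# H = carrier G - H"
  proof
    show "\<alpha> <# H \<subseteq> carrier G - H"
    proof
      fix y assume "y \<in> \<alpha> <# H"
      then obtain h where h: "h \<in> H" "y = \<alpha> \<otimes> h" unfolding l_coset_def by blast
      then have "C y = C h + C \<alpha>" "y \<in> carrier G" using \<alpha> by (simp_all add: H_def add.commute)
      moreover have "C h + C \<alpha> \<notin> P" using h \<alpha> by (intro nPP) (simp_all add: H_def)
      ultimately show "y \<in> carrier G - H" unfolding H_def by fastforce
    qed
    show "carrier G - H \<subseteq> \<alpha> <# H"
    proof
      fix x assume x: "x \<in> carrier G - H"
      have "inv \<alpha> \<otimes> x \<in> H" using x \<alpha> nP by (auto simp: H_def)
      moreover have "x = \<alpha> \<otimes> (inv \<alpha> \<otimes> x)" using x \<alpha> by (simp flip: m_assoc)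
      ultimately show "x \<in> \<alpha> <# H" unfolding l_coset_def by blast
    qed
  qed
  have coset: "H #> x = (if x \<in> H then H else carrier G - H)" if x: "x \<in> carrier G" for x
  proof (cases "x \<in> H")
    case True
    then show ?thesis using H by (simp add: coset_join2 x)
  next
    case False
    have "H #> x \<subseteq> carrier G - H"
    proof
      fix y assume "y \<in> H #> x"
      then obtain h where h: "h \<in> H" "y = h \<otimes> x" unfolding r_coset_def by blast
      moreover have "C h + C x \<notin> P" using h x False by (intro nPP) (simp_all add: H_def)
      ultimately show "y \<in> carrier G - H" using x by (simp add: H_def)
    qed
    moreover have "carrier G - H \<subseteq> H #> x"
    proof
      fix y assume y: "y \<in> carrier G - H"
      have "y \<otimes> inv x \<in> H" using x y False nP by (auto simp: H_def)
      moreover have "y = (y \<otimes> inv x) \<otimes> x" using x y by (simp add: m_assoc)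
      ultimately show "y \<in> H #> x" unfolding r_coset_def by blast
    qed
    ultimately show ?thesis using False by auto
  qed
  have "\<one> \<in> H" using H by (rule subgroup.one_closed)
  then have "rcosets H = {H, carrier G - H}"
    using coset \<alpha> by (auto simp: RCOSETS_def split: if_splits)
  moreover have "H \<noteq> carrier G - H" using \<open>\<one> \<in> H\<close> by blast
  ultimately have "card (rcosets H) = 2" by simp
  moreover have "nonzero_elems G - subseq_sums G T \<subseteq> carrier G - H"
  proof
    fix x assume x: "x \<in> nonzero_elems G - subseq_sums G T"
    have "\<not> reach n (image_mset L T) (L x)" using subseq_sumsI[OF over] x by blast
    then have "C x \<notin> P" using cov unfolding covered_def C_def P_def by blast
    then show "x \<in> carrier G - H" using x by (auto simp: H_def nonzero_elems_def)
  qed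
  ultimately show ?thesis using H \<alpha> left by blast
qed

section \<open>The Davenport constant and the two thresholds\<close>

lemma generator: obtains t where "t \<in> carrier G" "L t = (0, 0, 1)"
  using L_surj[of 1 0 0] n by auto

lemma small_davenport_eq: "small_davenport G = 2 * n + 1"
  unfolding small_davenport_def
proof (rule Max_eqI)
  have le: "k \<le> 2 * n + 1" if "k \<in> {size T | T. zero_sum_free G T}" for k
  proof -
    from that obtain T where "k = size T" "zero_sum_free G T" by auto
    then show ?thesis using size_zfree_le[OF n, of "image_mset L T"] by (simp add: zero_sum_free_iff)
  qed
  then show "finite {size T | T. zero_sum_free G T}"
    by (meson atMost_iff finite_atMost finite_subset subsetI)
  show "k \<le> 2 * n + 1" if "k \<in> {size T | T. zero_sum_free G T}" for k using that by (rule le)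
  obtain t where t: "t \<in> carrier G" "L t = (0, 0, 1)" by (rule generator)
  obtain a where a: "a \<in> carrier G" "L a = (1, 0, 0)" using L_surj[of 0 1 0] n by auto
  obtain b where b: "b \<in> carrier G" "L b = (0, 1, 0)" using L_surj[of 0 0 1] n by auto
  let ?T = "replicate_mset (2 * n - 1) t + {#a, b#}"
  have "zero_sum_free G ?T"
    using zfree_example[OF n] t a b by (simp add: zero_sum_free_iff seq_over_def image_replicate_mset)
  moreover have "size ?T = 2 * n + 1" using n by simp
  ultimately show "2 * n + 1 \<in> {size T | T. zero_sum_free G T}" by (metis (mono_tags) mem_Collect_eq)
qed

text \<open>The subsums of a power of \<open>t\<close> stay in the subgroup generated by
  \<open>t\<close>, which is the kernel of the projection \<open>d\<close>, so everything outside
  this kernel is missed. No coset of a proper subgroup contains all of that; hence one sequence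
  bounds both \<open>nu G\<close> and \<open>nu_p 2 G\<close> from below.\<close>

lemma uncovered_example:
  obtains T where "zero_sum_free G T" "size T = 2 * n - 1"
    "\<And>H \<alpha>. subgroup H G \<Longrightarrow> H \<subset> carrier G \<Longrightarrow> \<alpha>
      \<in> carrier G \<Longrightarrow>
      \<not> nonzero_elems G - subseq_sums G T \<subseteq> \<alpha> <# H"
proof -
  obtain t where t: "t \<in> carrier G" "L t = (0, 0, 1)" by (rule generator)
  define T where "T = replicate_mset (2 * n - 1) t"
  have over: "seq_over G T" using t by (auto simp: T_def seq_over_def)
  have image: "image_mset L T = replicate_mset (2 * n - 1) (0, 0, 1)" by
    (simp add: T_def t image_replicate_mset)
  have free: "zero_sum_free G T"
    using zfree_subset[OF zfree_example[OF n]] over by (simp add: zero_sum_free_iff image)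
  define d where "d x = (fst (C x), fst (snd (C x)))" for x
  have d_mult: "d (x \<otimes> y) = d x + d y" if "x \<in> carrier G" "y \<in> carrier G" for x y
    using that by (simp add: d_def)
  have d_surj: "\<exists>x \<in> carrier G. d x = v" for v
  proof -
    obtain x where "x \<in> carrier G" "C x = (fst v, snd v, 0)" using C_surj by blast
    moreover from this have "d x = v" by (simp add: d_def)
    ultimately show ?thesis by blast
  qed
  have d0: "d x = 0" if "x \<in> insert \<one> (subseq_sums G T)" for x
  proof -
    have "d (seq_sum G S) = 0" if "S \<subseteq># T" for S
      using that
    proof (induction S)
      case empty
      then show ?case by (simp add: seq_sum_def d_def zero_prod_def)
    next
      case (add s S)
      then have S: "S \<subseteq># T" "s \<in># T" by (auto dest: mset_subset_eq_insertD mset_subset_eqD)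
      have "seq_over G (add_mset s S)" "seq_over G S"
        using over add.prems S(1) by (auto simp: seq_over_def dest: mset_subset_eqD)
      moreover have "s = t" using S(2) by (auto simp: T_def split: if_splits)
      then have "d s = 0" by (simp add: d_def C_def cls_def t zero_prod_def)
      ultimately show ?case
        using add.IH[OF S(1)] by (simp add: seq_sum_add_mset d_mult seq_sum_closed seq_over_def)
    qed
    moreover have "d \<one> = 0" by (simp add: d_def zero_prod_def)
    ultimately show ?thesis using that unfolding subseq_sums_def by blast
  qed
  have False if H: "subgroup H G" "H \<subset> carrier G" and \<alpha>: "\<alpha> \<in> carrier G"
    and sub: "nonzero_elems G - subseq_sums G T \<subseteq> \<alpha> <# H" for H \<alpha>
  proof -
    interpret H: subgroup H G by fact
    have mem: "x \<in> \<alpha> <# H" if "x \<in> carrier G" "d x \<noteq> 0" for x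
      using that d0 sub unfolding nonzero_elems_def by blast
    have "x \<in> H" if x: "x \<in> carrier G" for x
    proof -
      \<comment> \<open>Every element of the four-element quotient is a difference of two nonzero
        ones. So \<open>x\<close> is a quotient of two missed elements of one coset of
        \<open>H\<close>, and lies in \<open>H\<close>.\<close>
      have "\<exists>v :: bit \<times> bit. v \<noteq> 0 \<and> d x + v \<noteq> 0"
      proof (cases "d x = (1, 0)")
        case True
        then show ?thesis by (intro exI[of _ "(0, 1)"]) (simp add: zero_prod_def)
      next
        case False
        obtain e f where "d x = (e, f)" by (cases "d x")
        with False show ?thesis by (intro exI[of _ "(1, 0)"]; cases e; cases f; simp add: zero_prod_def)
      qed
      then obtain y where y: "y \<in> carrier G" "d y \<noteq> 0" "d (x \<otimes> y) \<noteq> 0"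
        using d_surj d_mult[OF x] by metis
      obtain g h where gh: "g \<in> H" "h \<in> H" "y = \<alpha> \<otimes> g"
        "x \<otimes> y = \<alpha> \<otimes> h"
        using mem[of y] mem[of "x \<otimes> y"] x y unfolding l_coset_def by auto
      then have "\<alpha> \<otimes> (x \<otimes> g) = \<alpha> \<otimes> h" using x \<alpha> H.subset by
        (metis H.mem_carrier m_lcomm)
      then have "x \<otimes> g = h" using x \<alpha> gh H.mem_carrier by simp
      then have "x = h \<otimes> inv g" using x gh H.mem_carrier by (simp add: inv_solve_right)
      then show "x \<in> H" using gh by simp
    qed
    with H(2) show False by blast
  qed
  then show ?thesis using free by (intro that[of T]) (auto simp: T_def)
qed

lemma nu_eq: "nu G = 2 * n" "nu_p 2 G = 2 * n"
proof -
  obtain T where T: "zero_sum_free G T" "size T = 2 * n - 1"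
    and unc: "\<And>H \<alpha>. subgroup H G \<Longrightarrow> H \<subset> carrier G \<Longrightarrow>
      \<alpha> \<in> carrier G \<Longrightarrow>
      \<not> nonzero_elems G - subseq_sums G T \<subseteq> \<alpha> <# H"
    by (rule uncovered_example) blast
  have ps: "H \<subset> carrier G" if "subgroup H G" "\<alpha> \<in> carrier G - H" for H \<alpha>
    using that subgroup.subset by blast
  show "nu G = 2 * n"
    unfolding nu_def
  proof (rule Least_equality)
    show "\<forall>T. zero_sum_free G T \<and> size T \<ge> 2 * n \<longrightarrow>
      (\<exists>H \<alpha>. subgroup H G \<and> H \<subset> carrier G \<and> \<alpha> \<in> carrier G - H \<and>
        nonzero_elems G - subseq_sums G T \<subseteq> \<alpha> <# H)"
      using covering_subgroup ps by metis
  next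
    fix l assume "\<forall>T. zero_sum_free G T \<and> size T \<ge> l \<longrightarrow>
      (\<exists>H \<alpha>. subgroup H G \<and> H \<subset> carrier G \<and> \<alpha> \<in> carrier G - H \<and>
        nonzero_elems G - subseq_sums G T \<subseteq> \<alpha> <# H)"
    then have "\<not> l \<le> 2 * n - 1" using T unc by (metis DiffD1)
    then show "2 * n \<le> l" by simp
  qed
  show "nu_p 2 G = 2 * n"
    unfolding nu_p_def
  proof (rule Least_equality)
    show "\<forall>T. zero_sum_free G T \<and> size T \<ge> 2 * n \<longrightarrow>
      (\<exists>H \<alpha>. subgroup H G \<and> card (rcosets H) = 2 \<and> \<alpha> \<in> carrier G - H \<and>
        nonzero_elems G - subseq_sums G T \<subseteq> \<alpha> <# H)"
      using covering_subgroup by blast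
  next
    fix l assume "\<forall>T. zero_sum_free G T \<and> size T \<ge> l \<longrightarrow>
      (\<exists>H \<alpha>. subgroup H G \<and> card (rcosets H) = 2 \<and> \<alpha> \<in> carrier G - H \<and>
        nonzero_elems G - subseq_sums G T \<subseteq> \<alpha> <# H)"
    then have "\<not> l \<le> 2 * n - 1" using T unc ps by (metis DiffD1)
    then show "2 * n \<le> l" by simp
  qed
qed

end

theorem theorem4p7:
  fixes G :: "('a, 'b) monoid_scheme" and n :: nat
  assumes "comm_group G"
    and "n \<ge> 1"
    and "G \<cong> integer_mod_group 2 \<times>\<times> integer_mod_group 2 \<times>\<times>
      integer_mod_group (2 * n)"
  shows "nu G = nu_p 2 G \<and> int (nu_p 2 G) = int (small_davenport G) - 1"
proof -
  let ?K = "integer_mod_group 2 \<times>\<times> integer_mod_group 2 \<times>\<times> integer_mod_group (2 * n)"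
  obtain f where f: "f \<in> hom G ?K" "bij_betw f (carrier G) (carrier ?K)"
    using assms(3) by (auto simp: is_iso_def iso_def)
  define L :: "'a \<Rightarrow> elt" where
    "L x = (of_int (fst (f x)), of_int (fst (snd (f x))), snd (snd (f x)))" for x
  \<comment> \<open>Here \<open>n\<close> must be positive: modulo 0 the last factor would be all
    integers.\<close>
  have K: "carrier ?K = {0..<2} \<times> {0..<2} \<times> {0..<2 * int n}"
    using assms(2) by (simp add: carrier_integer_mod_group)
  have mod2: "(of_int (k mod 2) :: bit) = of_int k" for k
    by (simp add: of_int_bit_eq_iff minus_mod_eq_mult_div)
  have dvd_mod: "2 * int n dvd k mod (2 * int n) - k" for k
    by (metis mod_eq_dvd_iff mod_mod_trivial)
  \<comment> \<open>Reduction modulo \<open>2 * n\<close> preserves parity, so it does not affect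
    the third component of \<open>cls\<close>.\<close>
  have modn: "(of_int (k mod (2 * int n)) :: bit) = of_int k" for k
    unfolding of_int_bit_eq_iff using dvd_mod by (rule dvd_mult_left)
  have odd: "(of_int k :: bit) = 1 \<longleftrightarrow> odd k" for k
    using of_int_bit_eq_iff[of k 1] by simp
  interpret comm_group G by fact
  interpret lift G n L
  proof unfold_locales
    show "n \<ge> 1" by fact
  next
    fix x y assume xy: "x \<in> carrier G" "y \<in> carrier G"
    then have "f (x \<otimes>\<^bsub>G\<^esub> y) = f x \<otimes>\<^bsub>?K\<^esub> f y" using f(1) by
      (simp add: hom_def)
    then have "f (x \<otimes>\<^bsub>G\<^esub> y) = ((fst (f x) + fst (f y)) mod 2, (fst (snd (f x)) + fst
      (snd (f y))) mod 2,
        (snd (snd (f x)) + snd (snd (f y))) mod (2 * int n))"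
      by (simp add: mult_DirProd')
    then show "null n (L (x \<otimes>\<^bsub>G\<^esub> y) - (L x + L y))"
      by (simp add: null_def L_def cls_def val_def mod2 modn dvd_mod zero_prod_def)
  next
    fix x y assume xy: "x \<in> carrier G" "y \<in> carrier G" and null: "null n (L x - L y)"
    have "f x \<in> carrier ?K" "f y \<in> carrier ?K" using f(2) xy by (auto simp: bij_betw_def)
    then obtain a b c a' b' c' where xyf: "f x = (a, b, c)" "f y = (a', b', c')"
      and r: "0 \<le> a" "a < 2" "0 \<le> a'" "a' < 2" "0 \<le> b" "b < 2" "0 \<le> b'" "b' < 2"
        "0 \<le> c" "c < 2 * int n" "0 \<le> c'" "c' < 2 * int n"
      unfolding K by (cases "f x"; cases "f y") auto
    have "even (a - a')" "even (b - b')" "2 * int n dvd c - c'"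
      using null by (simp_all add: null_def L_def cls_def val_def zero_prod_def xyf odd)
    then have "a mod 2 = a' mod 2" "b mod 2 = b' mod 2" "c mod (2 * int n) = c' mod (2 * int n)"
      by (simp_all only: mod_eq_dvd_iff)
    then have "f x = f y" using r by (simp add: xyf)
    with xy f(2) show "x = y" by (auto simp: bij_betw_def inj_on_def)
  next
    fix a b :: bit and c :: int assume c: "0 \<le> c" "c < 2 * int n"
    define i :: "bit \<Rightarrow> int" where "i e = (if e = 0 then 0 else 1)" for e
    have i: "i e \<in> {0..<2}" "of_int (i e) = e" for e by (cases e; simp add: i_def)+
    have "(i a, i b, c) \<in> carrier ?K" unfolding K using i c by auto
    then obtain x where "x \<in> carrier G" "f x = (i a, i b, c)" using f(2) unfolding bij_betw_def by
      (metis imageE)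
    then show "\<exists>x \<in> carrier G. L x = (a, b, c)" by (intro bexI[of _ x]) (simp_all add: L_def i)
  qed
  show ?thesis by (simp add: nu_eq small_davenport_eq)
qed

end
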